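(* Let $\mathcal{D}$ be a distribution on $\{-1,1\}^n\times[0,1]$ whose marginal on $\{-1,1\}^n$ is uniform and with $\mathbb{E}[y\mid\mathbf{x}]=u(f(\mathbf{x}))$ for some known non-decreasing $L$-Lipschitz $u:\mathbb{R}\to[0,1]$ and some $f:\{-1,1\}^n\to[-M,M]$. If $f$ is $(\epsilon,d)$-Fourier concentrated, then there exists an algorithm that draws $m$ i.i.d. samples from $\mathcal{D}$ and outputs a hypothesis $h$ such that with probability $1-\delta$, $\varepsilon(h)\le O(L\epsilon)$, for $m=\mathrm{poly}(n^d,M,1/\epsilon,\log(1/\delta))$, in time $\mathrm{poly}(n^d,M,1/\epsilon,\log(1/\delta))$.
   Context: A function $f:\{-1,1\}^n\to\mathbb{R}$ is $(\epsilon,d)$-Fourier concentrated if $\sum_{S\subseteq[n]:|S|>d}\hat f(S)^2\le\epsilon^2$, where $\hat f(S)$ are the Fourier coefficients of $f$ with respect to the uniform distribution. For a hypothesis $h$, $\varepsilon(h)=\mathbb{E}_{(\mathbf{x},y)\sim\mathcal{D}}[(h(\mathbf{x})-\mathbb{E}[y\mid\mathbf{x}])^2]$. *)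

theory Defs
  imports "HOL-Probability.Probability"
begin

text \<open>Coordinates are numbered \<open>0, \<dots>, n - 1\<close>; a point of the cube is an extensional function.\<close>

definition cube :: "nat \<Rightarrow> (nat \<Rightarrow> real) set" where
  "cube n = {..<n} \<rightarrow>\<^sub>E {- 1, 1}"

definition parity :: "nat set \<Rightarrow> (nat \<Rightarrow> real) \<Rightarrow> real" where
  "parity S x = (\<Prod>i\<in>S. x i)"

definition fourier_coeff :: "nat \<Rightarrow> ((nat \<Rightarrow> real) \<Rightarrow> real) \<Rightarrow> nat set \<Rightarrow> real" where
  "fourier_coeff n f S = (\<integral>x. f x * parity S x \<partial>uniform_count_measure (cube n))"

definition fourier_concentrated :: "nat \<Rightarrow> real \<Rightarrow> nat \<Rightarrow> ((nat \<Rightarrow> real) \<Rightarrow> real) \<Rightarrow> bool" where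
  "fourier_concentrated n \<epsilon> d f \<longleftrightarrow>
     (\<Sum>S \<in> {S. S \<subseteq> {..<n} \<and> card S > d}. (fourier_coeff n f S)\<^sup>2) \<le> \<epsilon>\<^sup>2"

type_synonym example = "(nat \<Rightarrow> real) \<times> real"

definition example_space :: "nat \<Rightarrow> example measure" where
  "example_space n = count_space (cube n) \<Otimes>\<^sub>M restrict_space borel {0..1}"

definition uniform_marginal_dist :: "nat \<Rightarrow> example measure \<Rightarrow> bool" where
  "uniform_marginal_dist n D \<longleftrightarrow>
     prob_space D \<and> sets D = sets (example_space n) \<and>
     distr D (count_space (cube n)) fst = uniform_count_measure (cube n)"

definition label_mean :: "nat \<Rightarrow> example measure \<Rightarrow> example \<Rightarrow> real" where
  "label_mean n D =
     real_cond_exp D (vimage_algebra (space D) fst (count_space (cube n))) snd"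

definition hyp_error :: "nat \<Rightarrow> example measure \<Rightarrow> ((nat \<Rightarrow> real) \<Rightarrow> real) \<Rightarrow> real" where
  "hyp_error n D h = (\<integral>p. (h (fst p) - label_mean n D p)\<^sup>2 \<partial>D)"

text \<open>
  Algorithms are programs of a real RAM with oracles. A program uses finitely many natural-number
  registers and finitely many arrays of exact reals, the latter addressed by natural numbers. Every arithmetic operation, comparison, memory access,
  evaluation of the known function \<open>u\<close> and call to the example oracle takes one time step.
  Natural numbers can only be added and subtracted, so that their bit length grows at most linearly
  with the running time; reals cannot be converted back to naturals (in particular, there is no
  floor operation); and the only constants are natural numbers, so that no information is hidden in
  real constants.
\<close>

datatype iexp =
    INum nat
  | IReg nat
  | IAdd iexp iexp
  | ISub iexp iexp

datatype rexp =
    RNat iexp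
  | RGet nat iexp
  | RAdd rexp rexp
  | RSub rexp rexp
  | RMul rexp rexp
  | RDiv rexp rexp
  | ROracle rexp

datatype bexp =
    ILess iexp iexp
  | RLess rexp rexp
  | BNot bexp
  | BAnd bexp bexp

datatype com =
    Skip
  | ISet nat iexp
  | RSet nat iexp rexp
  | Draw
  | Seq com com
  | Cond bexp com com
  | While bexp com

record store =
  reg :: "nat \<Rightarrow> nat"
  arr :: "nat \<Rightarrow> nat \<Rightarrow> real"
  drawn :: nat

primrec ival :: "store \<Rightarrow> iexp \<Rightarrow> nat" where
  "ival s (INum k) = k"
| "ival s (IReg r) = reg s r"
| "ival s (IAdd a b) = ival s a + ival s b"
| "ival s (ISub a b) = ival s a - ival s b"

primrec rval :: "(real \<Rightarrow> real) \<Rightarrow> store \<Rightarrow> rexp \<Rightarrow> real" where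
  "rval u s (RNat a) = real (ival s a)"
| "rval u s (RGet k a) = arr s k (ival s a)"
| "rval u s (RAdd a b) = rval u s a + rval u s b"
| "rval u s (RSub a b) = rval u s a - rval u s b"
| "rval u s (RMul a b) = rval u s a * rval u s b"
| "rval u s (RDiv a b) = rval u s a / rval u s b"
| "rval u s (ROracle a) = u (rval u s a)"

primrec bval :: "(real \<Rightarrow> real) \<Rightarrow> store \<Rightarrow> bexp \<Rightarrow> bool" where
  "bval u s (ILess a b) \<longleftrightarrow> ival s a < ival s b"
| "bval u s (RLess a b) \<longleftrightarrow> rval u s a < rval u s b"
| "bval u s (BNot b) \<longleftrightarrow> \<not> bval u s b"
| "bval u s (BAnd a b) \<longleftrightarrow> bval u s a \<and> bval u s b"

primrec icost :: "iexp \<Rightarrow> nat" where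
  "icost (INum k) = 1"
| "icost (IReg r) = 1"
| "icost (IAdd a b) = icost a + icost b + 1"
| "icost (ISub a b) = icost a + icost b + 1"

primrec rcost :: "rexp \<Rightarrow> nat" where
  "rcost (RNat a) = icost a + 1"
| "rcost (RGet k a) = icost a + 1"
| "rcost (RAdd a b) = rcost a + rcost b + 1"
| "rcost (RSub a b) = rcost a + rcost b + 1"
| "rcost (RMul a b) = rcost a + rcost b + 1"
| "rcost (RDiv a b) = rcost a + rcost b + 1"
| "rcost (ROracle a) = rcost a + 1"

primrec bcost :: "bexp \<Rightarrow> nat" where
  "bcost (ILess a b) = icost a + icost b + 1"
| "bcost (RLess a b) = rcost a + rcost b + 1"
| "bcost (BNot b) = bcost b + 1"
| "bcost (BAnd a b) = bcost a + bcost b + 1"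

definition set_reg :: "nat \<Rightarrow> nat \<Rightarrow> store \<Rightarrow> store" where
  "set_reg r v s = s\<lparr>reg := (reg s)(r := v)\<rparr>"

definition set_cell :: "nat \<Rightarrow> nat \<Rightarrow> real \<Rightarrow> store \<Rightarrow> store" where
  "set_cell k i v s = s\<lparr>arr := (arr s)(k := (arr s k)(i := v))\<rparr>"

definition load_point :: "nat \<Rightarrow> (nat \<Rightarrow> real) \<Rightarrow> store \<Rightarrow> store" where
  "load_point n x s = s\<lparr>arr := (arr s)(0 := override_on (arr s 0) x {..<n})\<rparr>"

text \<open>
  The example oracle puts the next point into cells \<open>0, \<dots>, n - 1\<close> of array \<open>0\<close> and its label into
  cell \<open>0\<close> of array \<open>1\<close>.
\<close>

definition load_example :: "nat \<Rightarrow> (nat \<Rightarrow> example) \<Rightarrow> store \<Rightarrow> store" where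
  "load_example n \<omega> s =
     (set_cell 1 0 (snd (\<omega> (drawn s))) (load_point n (fst (\<omega> (drawn s))) s))
       \<lparr>drawn := Suc (drawn s)\<rparr>"

text \<open>
  \<open>exec u n \<omega> c s t s'\<close>: started in \<open>s\<close>, the program \<open>c\<close> halts in \<open>s'\<close> after \<open>t\<close> steps, where
  \<open>\<omega>\<close> lists the examples that the example oracle returns.
\<close>

inductive exec ::
  "(real \<Rightarrow> real) \<Rightarrow> nat \<Rightarrow> (nat \<Rightarrow> example) \<Rightarrow> com \<Rightarrow> store \<Rightarrow> nat \<Rightarrow> store \<Rightarrow> bool"
  for u n \<omega> where
  exec_Skip: "exec u n \<omega> Skip s 1 s"
| exec_ISet: "exec u n \<omega> (ISet r a) s (icost a + 1) (set_reg r (ival s a) s)"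
| exec_RSet: "exec u n \<omega> (RSet k a e) s (icost a + rcost e + 1)
                (set_cell k (ival s a) (rval u s e) s)"
| exec_Draw: "exec u n \<omega> Draw s 1 (load_example n \<omega> s)"
| exec_Seq: "exec u n \<omega> c1 s t1 s1 \<Longrightarrow> exec u n \<omega> c2 s1 t2 s2 \<Longrightarrow>
               exec u n \<omega> (Seq c1 c2) s (t1 + t2) s2"
| exec_CondT: "bval u s b \<Longrightarrow> exec u n \<omega> c1 s t s' \<Longrightarrow>
                 exec u n \<omega> (Cond b c1 c2) s (bcost b + t) s'"
| exec_CondF: "\<not> bval u s b \<Longrightarrow> exec u n \<omega> c2 s t s' \<Longrightarrow>
                 exec u n \<omega> (Cond b c1 c2) s (bcost b + t) s'"
| exec_WhileF: "\<not> bval u s b \<Longrightarrow> exec u n \<omega> (While b c) s (bcost b) s"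
| exec_WhileT: "bval u s b \<Longrightarrow> exec u n \<omega> c s t1 s1 \<Longrightarrow> exec u n \<omega> (While b c) s1 t2 s2 \<Longrightarrow>
                  exec u n \<omega> (While b c) s (bcost b + t1 + t2) s2"

lemma exec_deterministic:
  "exec u n \<omega> c s t s' \<Longrightarrow> exec u n \<omega> c s t' s'' \<Longrightarrow> t' = t \<and> s'' = s'"
proof (induction arbitrary: t' s'' rule: exec.induct)
  case (exec_Skip s)
  then show ?case by cases simp
next
  case (exec_ISet r a s)
  then show ?case by cases simp
next
  case (exec_RSet k a e s)
  then show ?case by cases simp
next
  case (exec_Draw s)
  then show ?case by cases simp
next
  case (exec_Seq c1 s t1 s1 c2 t2 s2)
  from exec_Seq.prems show ?case
  proof cases
    case (exec_Seq t1' s1' t2')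
    with exec_Seq.IH show ?thesis by blast
  qed
next
  case (exec_CondT b s c1 t s' c2)
  from exec_CondT.prems show ?case
    by cases (use exec_CondT.IH exec_CondT.hyps in blast)+
next
  case (exec_CondF b s c2 t s' c1)
  from exec_CondF.prems show ?case
    by cases (use exec_CondF.IH exec_CondF.hyps in blast)+
next
  case (exec_WhileF b s c)
  from exec_WhileF.prems show ?case
    by cases (use exec_WhileF.hyps in blast)+
next
  case (exec_WhileT b s c t1 s1 t2 s2)
  from exec_WhileT.prems show ?case
    by cases (use exec_WhileT.IH exec_WhileT.hyps in blast)+
qed

definition init_store :: "nat \<Rightarrow> nat \<Rightarrow> real \<Rightarrow> real \<Rightarrow> real \<Rightarrow> real \<Rightarrow> store" where
  "init_store n d M L \<epsilon> \<delta> =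
     \<lparr>reg = (\<lambda>_. 0)(0 := n, 1 := d),
      arr = (\<lambda>_ _. 0)(2 := (\<lambda>_. 0)(0 := M, 1 := L, 2 := \<epsilon>, 3 := \<delta>)),
      drawn = 0\<rparr>"

text \<open>
  A learning algorithm consists of a training program and a prediction program. The hypothesis
  that is output is represented by the memory contents when training ends; the prediction program
  evaluates it at a given point, without drawing further examples, and leaves the value in cell
  \<open>0\<close> of array \<open>1\<close>. By determinism, \<open>h\<close> below is unique on the cube.
\<close>

type_synonym learner = "com \<times> com"

definition outputs_hyp ::
  "learner \<Rightarrow> (real \<Rightarrow> real) \<Rightarrow> nat \<Rightarrow> nat \<Rightarrow> real \<Rightarrow> real \<Rightarrow> real \<Rightarrow> real \<Rightarrow> (nat \<Rightarrow> example) \<Rightarrow>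
     nat \<Rightarrow> real \<Rightarrow> ((nat \<Rightarrow> real) \<Rightarrow> real) \<Rightarrow> bool" where
  "outputs_hyp A u n d M L \<epsilon> \<delta> \<omega> m T h \<longleftrightarrow>
     (\<exists>t s. exec u n \<omega> (fst A) (init_store n d M L \<epsilon> \<delta>) t s \<and> drawn s = m \<and> real t \<le> T \<and>
        (\<forall>x \<in> cube n. \<exists>t' s'. exec u n \<omega> (snd A) (load_point n x s) t' s' \<and>
            drawn s' = m \<and> real t' \<le> T \<and> arr s' 1 0 = h x))"

definition is_polynomial4 :: "(real \<Rightarrow> real \<Rightarrow> real \<Rightarrow> real \<Rightarrow> real) \<Rightarrow> bool" where
  "is_polynomial4 P \<longleftrightarrow>
     (\<exists>k (c :: nat \<Rightarrow> nat \<Rightarrow> nat \<Rightarrow> nat \<Rightarrow> real).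
        P = (\<lambda>w x y z. \<Sum>i\<le>k. \<Sum>j\<le>k. \<Sum>p\<le>k. \<Sum>q\<le>k. c i j p q * w ^ i * x ^ j * y ^ p * z ^ q))"

end

theory Submission
  imports Defs
begin

text \<open>
  The learner is stochastic gradient descent on the convex surrogate loss whose gradient is
  \<open>(u (w \<bullet> \<phi> x) - y) * \<phi> x\<close>, with one fresh example per round, in kernel form. The kernel
  \<open>\<Prod>i<n. 1 + x i * y i / n\<close> is bounded by \<open>3\<close>, and its features are the parities scaled by
  \<open>n powr (- card S / 2)\<close>; hence the degree-\<open>d\<close> part \<open>g\<close> of \<open>f\<close> has squared norm at most \<open>M\<^sup>2 * n ^ d\<close>
  in feature space. Writing \<open>q\<^sub>t\<close> for the margin function of round \<open>t\<close>, monotonicity and the Lipschitz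
  condition give
  \<open>(u (q\<^sub>t x) - u (f x))\<^sup>2 \<le> L * (u (q\<^sub>t x) - u (f x)) * (q\<^sub>t x - f x)\<close>. Replacing \<open>f\<close> by \<open>g\<close> on the right
  costs at most \<open>\<epsilon>\<close> on average, by Fourier concentration; what remains is the expected regret of round
  \<open>t\<close> against \<open>g\<close>, which the regret bound for gradient descent and the Azuma--Hoeffding inequality
  control on average over the rounds. The hypothesis is the average of \<open>u (q\<^sub>t x)\<close> over all rounds; its
  error is at most the average error, so no round has to be selected. No parameter of the
  algorithm depends on \<open>L\<close>.
\<close>

section \<open>Fourier analysis on the cube\<close>

lemma finite_cube [simp]: "finite (cube n)"
  unfolding cube_def by (intro finite_PiE) auto

lemma card_cube [simp]: "card (cube n) = 2 ^ n"
  unfolding cube_def by (simp add: card_PiE numeral_2_eq_2)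

lemma cube_nonempty [simp]: "cube n \<noteq> {}"
  unfolding cube_def by (simp add: PiE_eq_empty_iff)

lemma cube_coord_square: "x \<in> cube n \<Longrightarrow> i < n \<Longrightarrow> x i * x i = 1"
  unfolding cube_def by (auto simp: PiE_iff dest: bspec[of _ _ i])

lemma cube_coord_abs: "x \<in> cube n \<Longrightarrow> i < n \<Longrightarrow> \<bar>x i\<bar> = 1"
  unfolding cube_def by (auto simp: PiE_iff dest: bspec[of _ _ i])

definition cube_avg :: "nat \<Rightarrow> ((nat \<Rightarrow> real) \<Rightarrow> real) \<Rightarrow> real" where
  "cube_avg n f = (\<Sum>x\<in>cube n. f x) / 2 ^ n"

lemma cube_avg_eq_integral: "cube_avg n f = (\<integral>x. f x \<partial>uniform_count_measure (cube n))"
  by (simp add: cube_avg_def integral_uniform_count_measure)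

lemma cube_avg_mono: "(\<And>x. x \<in> cube n \<Longrightarrow> f x \<le> g x) \<Longrightarrow> cube_avg n f \<le> cube_avg n g"
  unfolding cube_avg_def by (intro divide_right_mono sum_mono) auto

lemma cube_avg_const [simp]: "cube_avg n (\<lambda>_. c) = c"
  by (simp add: cube_avg_def)

lemma cube_avg_cong: "(\<And>x. x \<in> cube n \<Longrightarrow> f x = g x) \<Longrightarrow> cube_avg n f = cube_avg n g"
  by (simp add: cube_avg_def)

lemma cube_avg_add: "cube_avg n (\<lambda>x. f x + g x) = cube_avg n f + cube_avg n g"
  by (simp add: cube_avg_def sum.distrib add_divide_distrib)

lemma cube_avg_diff: "cube_avg n (\<lambda>x. f x - g x) = cube_avg n f - cube_avg n g"
  by (simp add: cube_avg_def sum_subtractf diff_divide_distrib)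

lemma cube_avg_cmult: "cube_avg n (\<lambda>x. c * f x) = c * cube_avg n f"
  by (simp add: cube_avg_def flip: sum_distrib_left)

lemma cube_avg_sum: "cube_avg n (\<lambda>x. \<Sum>i\<in>I. f i x) = (\<Sum>i\<in>I. cube_avg n (f i))"
  by (simp add: cube_avg_def sum_divide_distrib sum.swap[of _ _ I])

lemma fourier_coeff_avg: "fourier_coeff n f S = cube_avg n (\<lambda>x. f x * parity S x)"
  by (simp add: fourier_coeff_def cube_avg_eq_integral)

text \<open>Expanding the product of \<open>x i * y i + 1\<close> gives the sum over all subsets; a
  coordinate where the points differ contributes the factor 0, any other the factor 2.\<close>

lemma sum_parity_Pow:
  assumes "x \<in> cube n" "y \<in> cube n"
  shows "(\<Sum>S\<in>Pow {..<n}. parity S x * parity S y) = (if x = y then 2 ^ n else 0)"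
proof -
  have "(\<Sum>S\<in>Pow {..<n}. parity S x * parity S y) = (\<Prod>i<n. x i * y i + 1)"
    by (simp add: prod_add parity_def prod.distrib)
  also have "\<dots> = (if x = y then 2 ^ n else 0)"
  proof (cases "x = y")
    case True
    then show ?thesis using assms by (simp add: cube_coord_square)
  next
    case False
    then obtain i where i: "i < n" "x i \<noteq> y i"
      using assms PiE_ext[of x "{..<n}" _ y] unfolding cube_def by blast
    then have "x i * y i + 1 = 0"
      using assms unfolding cube_def by (auto simp: PiE_iff dest!: bspec[of _ _ i])
    then show ?thesis using i False by (auto intro!: prod_zero)
  qed
  finally show ?thesis .
qed

text \<open>Plancherel: once both coefficients are expanded, summing over \<open>S\<close> first
  leaves only the diagonal \<open>x = y\<close>.\<close>

lemma parseval:
  "(\<Sum>S\<in>Pow {..<n}. fourier_coeff n f S * fourier_coeff n g S) = cube_avg n (\<lambda>x. f x * g x)"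
proof -
  have "(\<Sum>S\<in>Pow {..<n}. fourier_coeff n f S * fourier_coeff n g S)
      = (\<Sum>S\<in>Pow {..<n}. \<Sum>x\<in>cube n. \<Sum>y\<in>cube n.
           f x * g y / (2 ^ n * 2 ^ n) * (parity S x * parity S y))"
    unfolding fourier_coeff_avg cube_avg_def
    by (simp add: sum_product sum_divide_distrib mult_ac)
  also have "\<dots> = (\<Sum>x\<in>cube n. \<Sum>y\<in>cube n.
           f x * g y / (2 ^ n * 2 ^ n) * (\<Sum>S\<in>Pow {..<n}. parity S x * parity S y))"
    unfolding sum_distrib_left
    by (subst sum.swap, intro sum.cong refl, subst sum.swap, rule refl)
  also have "\<dots> = (\<Sum>x\<in>cube n. \<Sum>y\<in>cube n. if x = y then f x * g x / 2 ^ n else 0)"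
    by (intro sum.cong refl) (simp add: sum_parity_Pow)
  also have "\<dots> = cube_avg n (\<lambda>x. f x * g x)"
    by (simp add: cube_avg_def sum_divide_distrib)
  finally show ?thesis .
qed

definition low_degree :: "nat \<Rightarrow> nat \<Rightarrow> ((nat \<Rightarrow> real) \<Rightarrow> real) \<Rightarrow> (nat \<Rightarrow> real) \<Rightarrow> real" where
  "low_degree n d f x =
     (\<Sum>S\<in>{S. S \<subseteq> {..<n} \<and> card S \<le> d}. fourier_coeff n f S * parity S x)"

text \<open>By Plancherel only coefficients of degree above \<open>d\<close> contribute.
  Cauchy-Schwarz then applies: those of \<open>a\<close> have squared norm at most 1 because
  \<open>a\<close> is bounded by 1, those of \<open>f\<close> at most
  \<open>\<epsilon>\<^sup>2\<close> by concentration.\<close>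

lemma high_degree_inner_le:
  assumes "fourier_concentrated n \<epsilon> d f" "0 \<le> \<epsilon>"
    and a: "\<And>x. x \<in> cube n \<Longrightarrow> \<bar>a x\<bar> \<le> 1"
  shows "cube_avg n (\<lambda>x. a x * (low_degree n d f x - f x)) \<le> \<epsilon>"
proof -
  let ?H = "{S. S \<subseteq> {..<n} \<and> card S > d}" and ?L = "{S. S \<subseteq> {..<n} \<and> card S \<le> d}"
  have fin: "finite ?L" "finite ?H"
    by (auto intro: finite_subset[of _ "Pow {..<n}"])
  have split: "(\<Sum>S\<in>Pow {..<n}. h S) = (\<Sum>S\<in>?L. h S) + (\<Sum>S\<in>?H. h S)" for h :: "nat set \<Rightarrow> real"
  proof -
    have "Pow {..<n} = ?L \<union> ?H" by auto
    then show ?thesis by (simp only:) (rule sum.union_disjoint[OF fin], auto)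
  qed
  have low: "cube_avg n (\<lambda>x. a x * low_degree n d f x)
      = (\<Sum>S\<in>?L. fourier_coeff n a S * fourier_coeff n f S)"
  proof -
    have "cube_avg n (\<lambda>x. a x * low_degree n d f x)
        = cube_avg n (\<lambda>x. \<Sum>S\<in>?L. fourier_coeff n f S * (a x * parity S x))"
      by (simp add: low_degree_def sum_distrib_left mult_ac)
    then show ?thesis
      by (simp add: cube_avg_sum cube_avg_cmult mult.commute flip: fourier_coeff_avg)
  qed
  have "cube_avg n (\<lambda>x. a x * (low_degree n d f x - f x))
      = - (\<Sum>S\<in>?H. fourier_coeff n a S * fourier_coeff n f S)"
    using parseval[of n a f] split low by (simp add: right_diff_distrib cube_avg_diff)
  also have "\<dots> \<le> \<bar>\<Sum>S\<in>?H. fourier_coeff n a S * fourier_coeff n f S\<bar>" by simp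
  also have "\<dots> \<le> \<epsilon>"
  proof (rule abs_le_square_iff[THEN iffD2, of _ \<epsilon>, simplified abs_of_nonneg[OF assms(2)]])
    have "(\<Sum>S\<in>?H. (fourier_coeff n a S)\<^sup>2) \<le> (\<Sum>S\<in>Pow {..<n}. (fourier_coeff n a S)\<^sup>2)"
      by (intro sum_mono2) auto
    also have "\<dots> = cube_avg n (\<lambda>x. a x * a x)"
      using parseval[of n a a] by (simp add: power2_eq_square)
    also have "\<dots> \<le> cube_avg n (\<lambda>_. 1)"
      using a by (intro cube_avg_mono) (simp add: abs_le_square_iff[of _ "1::real", simplified] flip: power2_eq_square)
    finally have "(\<Sum>S\<in>?H. (fourier_coeff n a S)\<^sup>2) \<le> 1" by simp
    moreover have "(\<Sum>S\<in>?H. (fourier_coeff n f S)\<^sup>2) \<le> \<epsilon>\<^sup>2"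
      using assms(1) by (simp add: fourier_concentrated_def)
    ultimately have "(\<Sum>S\<in>?H. (fourier_coeff n a S)\<^sup>2) * (\<Sum>S\<in>?H. (fourier_coeff n f S)\<^sup>2) \<le> 1 * \<epsilon>\<^sup>2"
      by (intro mult_mono) (auto intro: sum_nonneg)
    then show "(\<Sum>S\<in>?H. fourier_coeff n a S * fourier_coeff n f S)\<^sup>2 \<le> \<epsilon>\<^sup>2"
      using Cauchy_Schwarz_ineq_sum[of "fourier_coeff n a" "fourier_coeff n f" ?H] by simp
  qed
  finally show ?thesis .
qed

section \<open>A kernel for low-degree functions\<close>

definition kernel :: "nat \<Rightarrow> (nat \<Rightarrow> real) \<Rightarrow> (nat \<Rightarrow> real) \<Rightarrow> real" where
  "kernel k x y = (\<Prod>i<k. 1 + x i * y i / k)"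

text \<open>The feature map of \<open>kernel k\<close>. For \<open>k = 0\<close> only
  \<open>S = {}\<close> occurs in \<open>Pow {..<k}\<close>, and the zeroth power hides
  \<open>1 / 0 = 0\<close>.\<close>

definition feature :: "nat \<Rightarrow> nat set \<Rightarrow> (nat \<Rightarrow> real) \<Rightarrow> real" where
  "feature k S x = sqrt (1 / k) ^ card S * parity S x"

lemma kernel_eq_feature: "kernel k x y = (\<Sum>S\<in>Pow {..<k}. feature k S x * feature k S y)"
proof -
  have "kernel k x y = (\<Prod>i<k. x i * y i * (1 / k) + 1)"
    by (simp add: kernel_def add.commute)
  also have "\<dots> = (\<Sum>S\<in>Pow {..<k}. parity S x * parity S y * (1 / k) ^ card S)"
    by (simp add: prod_add parity_def prod_dividef prod.distrib power_one_over)
  also have "\<dots> = (\<Sum>S\<in>Pow {..<k}. feature k S x * feature k S y)"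
  proof (intro sum.cong refl)
    fix S :: "nat set"
    have "(1 / real k) ^ card S = sqrt (1 / k) ^ card S * sqrt (1 / k) ^ card S"
      by (simp flip: power_mult_distrib)
    then show "parity S x * parity S y * (1 / k) ^ card S = feature k S x * feature k S y"
      by (simp add: feature_def mult_ac)
  qed
  finally show ?thesis .
qed

text \<open>Each factor is at most \<open>1 + 1 / k \<le> exp (1 / k)\<close> in absolute value, so
  the product is at most \<open>exp 1\<close>, whatever the dimension.\<close>

lemma abs_kernel_le:
  assumes "x \<in> cube n" "y \<in> cube n" "k \<le> n"
  shows "\<bar>kernel k x y\<bar> \<le> 3"
proof (cases "k = 0")
  case False
  have "\<bar>1 + x i * y i / k\<bar> \<le> exp (1 / k)" if "i < k" for i
  proof -
    have "\<bar>1 + x i * y i / k\<bar> \<le> 1 + \<bar>x i * y i / k\<bar>" by linarith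
    also have "\<dots> = 1 + 1 / k"
      using that assms cube_coord_abs[of x n i] cube_coord_abs[of y n i]
      by (simp add: abs_mult)
    finally show ?thesis using exp_ge_add_one_self[of "1 / real k"] by linarith
  qed
  then have "\<bar>kernel k x y\<bar> \<le> (\<Prod>i<k. exp (1 / k))"
    unfolding kernel_def abs_prod by (intro prod_mono) auto
  also have "\<dots> = exp 1"
    using False by (simp flip: exp_of_nat_mult)
  finally show ?thesis using exp_le by linarith
qed (simp add: kernel_def)

text \<open>
  For \<open>n \<le> 1\<close> the loop that computes \<open>n ^ d\<close> would take \<open>d\<close> steps, which no polynomial in \<open>n ^ d\<close>
  allows; likewise \<open>n ^ 0 = 1\<close> leaves no time to read \<open>n\<close> coordinates.
\<close>

definition weight :: "nat \<Rightarrow> nat \<Rightarrow> real" where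
  "weight n d = (if n \<le> 1 then 1 else real n ^ d)"

definition eff_dim :: "nat \<Rightarrow> nat \<Rightarrow> nat" where
  "eff_dim n d = (if d = 0 then 0 else n)"

text \<open>The power of the square root cancels the scaling inside \<open>feature\<close>, so this
  vector represents \<open>low_degree n d f\<close> in feature space.\<close>

definition low_weights :: "nat \<Rightarrow> nat \<Rightarrow> ((nat \<Rightarrow> real) \<Rightarrow> real) \<Rightarrow> nat set \<Rightarrow> real" where
  "low_weights n d f S =
     (if card S \<le> d then fourier_coeff n f S * sqrt (eff_dim n d) ^ card S else 0)"

lemma eff_dim_le: "eff_dim n d \<le> n"
  by (simp add: eff_dim_def)

text \<open>For \<open>d = 0\<close> both sides contain only \<open>{}\<close>; otherwise
  \<open>eff_dim n d = n\<close>.\<close>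

lemma low_degree_sets: "{S. S \<subseteq> {..<n} \<and> card S \<le> d} = {S \<in> Pow {..<eff_dim n d}. card S \<le> d}"
  by (cases "d = 0") (auto simp: eff_dim_def intro: finite_subset dest: finite_subset[of _ "{..<n}"])

lemma weight_ge_1: "1 \<le> weight n d"
  by (simp add: weight_def)

lemma low_degree_eq_feature:
  "low_degree n d f x = (\<Sum>S\<in>Pow {..<eff_dim n d}. low_weights n d f S * feature (eff_dim n d) S x)"
proof -
  let ?k = "eff_dim n d"
  have "low_weights n d f S * feature ?k S x
      = (if card S \<le> d then fourier_coeff n f S * parity S x else 0)" if "S \<subseteq> {..<?k}" for S
  proof -
    have "sqrt ?k ^ card S * sqrt (1 / ?k) ^ card S = 1"
    proof (cases "?k = 0")
      case True
      then have "S = {}" using that by simp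
      then show ?thesis by simp
    qed (simp flip: power_mult_distrib real_sqrt_mult)
    then show ?thesis by (simp add: low_weights_def feature_def field_simps)
  qed
  then have "(\<Sum>S\<in>Pow {..<?k}. low_weights n d f S * feature ?k S x)
      = (\<Sum>S\<in>Pow {..<?k}. if card S \<le> d then fourier_coeff n f S * parity S x else 0)"
    by (intro sum.cong) auto
  also have "\<dots> = low_degree n d f x"
    unfolding low_degree_def low_degree_sets by (rule sum.inter_filter[symmetric]) simp
  finally show ?thesis by simp
qed

text \<open>Cancelling the scaling multiplies a squared coefficient by at most
  \<open>weight n d\<close>, and by Parseval the squared coefficients sum to at most
  \<open>M\<^sup>2\<close>.\<close>

lemma sum_low_weights_le:
  assumes f: "\<And>x. x \<in> cube n \<Longrightarrow> \<bar>f x\<bar> \<le> M"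
  shows "(\<Sum>S\<in>Pow {..<eff_dim n d}. (low_weights n d f S)\<^sup>2) \<le> M\<^sup>2 * weight n d"
proof -
  let ?k = "eff_dim n d"
  have "(low_weights n d f S)\<^sup>2 \<le> (fourier_coeff n f S)\<^sup>2 * weight n d" if "S \<subseteq> {..<?k}" for S
  proof (cases "card S \<le> d")
    case True
    have "real ?k ^ card S \<le> weight n d"
    proof (cases "?k = 0 \<or> n \<le> 1")
      case False
      then have "real ?k ^ card S \<le> real ?k ^ d"
        using True by (intro power_increasing) auto
      then show ?thesis using False by (simp add: weight_def eff_dim_def split: if_splits)
    next
      case True
      then have "?k \<le> 1" by (auto simp: eff_dim_def)
      then have "real ?k ^ card S \<le> 1" by (intro power_le_one) auto
      then show ?thesis using weight_ge_1[of n d] by linarith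
    qed
    moreover have "(sqrt ?k ^ card S)\<^sup>2 = real ?k ^ card S"
      by (simp flip: power_mult power_mult_distrib add: power2_eq_square)
    ultimately show ?thesis
      by (simp add: low_weights_def True power_mult_distrib mult_left_mono)
  next
    case False
    then show ?thesis using weight_ge_1[of n d] by (simp add: low_weights_def)
  qed
  then have "(\<Sum>S\<in>Pow {..<?k}. (low_weights n d f S)\<^sup>2)
      \<le> (\<Sum>S\<in>Pow {..<?k}. (fourier_coeff n f S)\<^sup>2 * weight n d)"
    by (intro sum_mono) auto
  also have "\<dots> \<le> (\<Sum>S\<in>Pow {..<n}. (fourier_coeff n f S)\<^sup>2 * weight n d)"
    using eff_dim_le[of n d] weight_ge_1[of n d] by (intro sum_mono2) auto
  also have "\<dots> = cube_avg n (\<lambda>x. f x * f x) * weight n d"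
    using parseval[of n f f] by (simp add: power2_eq_square flip: sum_distrib_right)
  also have "\<dots> \<le> cube_avg n (\<lambda>_. M\<^sup>2) * weight n d"
  proof (intro mult_right_mono cube_avg_mono)
    fix x assume "x \<in> cube n"
    then show "f x * f x \<le> M\<^sup>2"
      using f[of x] abs_le_square_iff[of "f x" M] by (simp add: power2_eq_square)
  qed (use weight_ge_1[of n d] in simp)
  finally show ?thesis by simp
qed

text \<open>Cauchy-Schwarz in feature space, where the squared norm of the features of
  \<open>x\<close> is \<open>kernel k x x\<close>.\<close>

lemma low_degree_square_le:
  assumes f: "\<And>x. x \<in> cube n \<Longrightarrow> \<bar>f x\<bar> \<le> M" and x: "x \<in> cube n"
  shows "(low_degree n d f x)\<^sup>2 \<le> 3 * (M\<^sup>2 * weight n d)"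
proof -
  let ?k = "eff_dim n d"
  have "(low_degree n d f x)\<^sup>2
      \<le> (\<Sum>S\<in>Pow {..<?k}. (low_weights n d f S)\<^sup>2) * (\<Sum>S\<in>Pow {..<?k}. (feature ?k S x)\<^sup>2)"
    unfolding low_degree_eq_feature by (rule Cauchy_Schwarz_ineq_sum)
  also have "\<dots> \<le> (M\<^sup>2 * weight n d) * 3"
  proof (intro mult_mono)
    show "(\<Sum>S\<in>Pow {..<?k}. (low_weights n d f S)\<^sup>2) \<le> M\<^sup>2 * weight n d"
      by (rule sum_low_weights_le[OF f])
    show "(\<Sum>S\<in>Pow {..<?k}. (feature ?k S x)\<^sup>2) \<le> 3"
      using abs_kernel_le[OF x x eff_dim_le, of d] by (simp add: kernel_eq_feature power2_eq_square)
    show "0 \<le> M\<^sup>2 * weight n d"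
      using weight_ge_1[of n d] by simp
  qed (simp add: sum_nonneg)
  finally show ?thesis by simp
qed

section \<open>Regret of gradient descent\<close>

text \<open>The standard analysis of unprojected gradient descent from the origin on linear losses.
  \<open>c\<close> and \<open>\<phi>\<close> are arbitrary bounded sequences, so no probability
  enters here.\<close>

lemma gradient_descent_regret:
  fixes \<phi> :: "'i \<Rightarrow> nat \<Rightarrow> real"
  assumes "0 < \<eta>"
    and c: "\<And>t. t < T \<Longrightarrow> \<bar>c t\<bar> \<le> 1"
    and \<phi>: "\<And>t. t < T \<Longrightarrow> (\<Sum>i\<in>I. (\<phi> i t)\<^sup>2) \<le> \<kappa>"
  defines "w \<equiv> \<lambda>t i. - (\<Sum>r<t. \<eta> * c r * \<phi> i r)"
  shows "(\<Sum>t<T. c t * (\<Sum>i\<in>I. (w t i - v i) * \<phi> i t)) \<le> (\<Sum>i\<in>I. (v i)\<^sup>2) / (2 * \<eta>) + \<eta> * \<kappa> * T / 2"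
proof -
  \<comment> \<open>the potential \<open>\<Sum>i\<in>I. (w t i - v i)\<^sup>2\<close> pays for the regret of each step\<close>
  have step: "2 * \<eta> * (c t * (\<Sum>i\<in>I. (w t i - v i) * \<phi> i t))
      \<le> (\<Sum>i\<in>I. (w t i - v i)\<^sup>2) - (\<Sum>i\<in>I. (w (Suc t) i - v i)\<^sup>2) + \<eta>\<^sup>2 * \<kappa>" if t: "t < T" for t
  proof -
    have "(\<Sum>i\<in>I. (w (Suc t) i - v i)\<^sup>2)
        = (\<Sum>i\<in>I. (w t i - v i)\<^sup>2 - 2 * \<eta> * c t * ((w t i - v i) * \<phi> i t) + \<eta>\<^sup>2 * (c t)\<^sup>2 * (\<phi> i t)\<^sup>2)"
      by (intro sum.cong refl) (simp add: w_def power2_eq_square algebra_simps)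
    also have "\<dots> = (\<Sum>i\<in>I. (w t i - v i)\<^sup>2) - 2 * \<eta> * c t * (\<Sum>i\<in>I. (w t i - v i) * \<phi> i t)
        + \<eta>\<^sup>2 * ((c t)\<^sup>2 * (\<Sum>i\<in>I. (\<phi> i t)\<^sup>2))"
      by (simp add: sum.distrib sum_subtractf sum_distrib_left mult_ac)
    finally have expand: "(\<Sum>i\<in>I. (w (Suc t) i - v i)\<^sup>2) = \<dots>" .
    have "(c t)\<^sup>2 * (\<Sum>i\<in>I. (\<phi> i t)\<^sup>2) \<le> 1 * \<kappa>"
      using c[OF t] \<phi>[OF t] by (intro mult_mono) (auto simp: abs_square_le_1 intro: sum_nonneg)
    then have "\<eta>\<^sup>2 * ((c t)\<^sup>2 * (\<Sum>i\<in>I. (\<phi> i t)\<^sup>2)) \<le> \<eta>\<^sup>2 * \<kappa>"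
      by (simp add: mult_left_mono)
    with expand show ?thesis by (simp only: mult.assoc)
  qed
  have "2 * \<eta> * (\<Sum>t<T. c t * (\<Sum>i\<in>I. (w t i - v i) * \<phi> i t))
      \<le> (\<Sum>t<T. (\<Sum>i\<in>I. (w t i - v i)\<^sup>2) - (\<Sum>i\<in>I. (w (Suc t) i - v i)\<^sup>2) + \<eta>\<^sup>2 * \<kappa>)"
    unfolding sum_distrib_left by (intro sum_mono step[unfolded sum_distrib_left]) auto
  also have "\<dots> = (\<Sum>i\<in>I. (w 0 i - v i)\<^sup>2) - (\<Sum>i\<in>I. (w T i - v i)\<^sup>2) + T * (\<eta>\<^sup>2 * \<kappa>)"
    by (simp only: sum.distrib sum_lessThan_telescope'[of "\<lambda>t. \<Sum>i\<in>I. (w t i - v i)\<^sup>2"])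
       simp
  also have "\<dots> \<le> (\<Sum>i\<in>I. (v i)\<^sup>2) + T * (\<eta>\<^sup>2 * \<kappa>)"
    by (simp add: w_def sum_nonneg)
  finally show ?thesis
    using \<open>0 < \<eta>\<close> by (simp add: field_simps power2_eq_square)
qed

section \<open>The Azuma--Hoeffding inequality on product spaces\<close>

text \<open>Induction on \<open>m\<close>, integrating the last coordinate first. Given the earlier
  coordinates, the last increment is centred with range of length \<open>2 * R\<close>, so
  Hoeffding's lemma contributes one factor \<open>exp (l\<^sup>2 * R\<^sup>2 / 2)\<close>.
  Non-negative integrals avoid integrability side conditions.\<close>

lemma nn_integral_exp_martingale_le:
  fixes F :: "nat \<Rightarrow> (nat \<Rightarrow> 'a) \<Rightarrow> 'a \<Rightarrow> real"
  assumes "prob_space D" and l: "0 < l"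
    and meas: "\<And>t. t < m \<Longrightarrow> case_prod (F t) \<in> borel_measurable (PiM {..<t} (\<lambda>_. D) \<Otimes>\<^sub>M D)"
    and bound: "\<And>t \<omega> p. t < m \<Longrightarrow> \<omega> \<in> space (PiM {..<t} (\<lambda>_. D)) \<Longrightarrow> p \<in> space D \<Longrightarrow> \<bar>F t \<omega> p\<bar> \<le> R"
  shows "(\<integral>\<^sup>+\<omega>. exp (l * (\<Sum>t<m. (\<integral>p. F t (restrict \<omega> {..<t}) p \<partial>D) - F t (restrict \<omega> {..<t}) (\<omega> t)))
            \<partial>PiM {..<m} (\<lambda>_. D)) \<le> ennreal (exp (m * (l\<^sup>2 * R\<^sup>2 / 2)))"
  using meas bound
proof (induction m)
  case 0
  interpret prob_space "PiM {} (\<lambda>_. D)" by (rule prob_space_PiM) auto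
  show ?case by (simp add: emeasure_space_1)
next
  case (Suc m)
  interpret D: prob_space D by fact
  interpret product_prob_space "\<lambda>_ :: nat. D" by standard
  let ?P = "\<lambda>t. PiM {..<t} (\<lambda>_. D)"
  define X where "X t \<omega> = (\<integral>p. F t (restrict \<omega> {..<t}) p \<partial>D) - F t (restrict \<omega> {..<t}) (\<omega> t)" for t \<omega>
  have X_meas: "X t \<in> borel_measurable (?P k)" if "t < k" "t < Suc m" for t k
  proof -
    note [measurable] = Suc.prems(1)[OF that(2)]
    have r: "(\<lambda>\<omega>. restrict \<omega> {..<t}) \<in> ?P k \<rightarrow>\<^sub>M ?P t"
      by (rule measurable_restrict_subset) (use that in auto)
    have *: "(\<lambda>\<omega>. \<integral>p. F t \<omega> p \<partial>D) \<in> borel_measurable (?P t)"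
      by (rule D.borel_measurable_lebesgue_integral) measurable
    have c: "(\<lambda>\<omega>. \<omega> t) \<in> ?P k \<rightarrow>\<^sub>M D"
      by (rule measurable_component_singleton) (use that in auto)
    have "(\<lambda>\<omega>. F t (restrict \<omega> {..<t}) (\<omega> t)) \<in> borel_measurable (?P k)"
      using measurable_compose[OF measurable_Pair[OF r c] Suc.prems(1)[OF that(2)]] by simp
    then show ?thesis
      unfolding X_def using measurable_compose[OF r *] by measurable
  qed
  have exp_meas: "(\<lambda>\<omega>. ennreal (exp (l * (\<Sum>t<k. X t \<omega>)))) \<in> borel_measurable (?P j)"
    if "k \<le> j" "k \<le> Suc m" for k j
    using X_meas that by (intro measurable_compose[OF _ measurable_ennreal] borel_measurable_exp
        borel_measurable_times borel_measurable_sum measurable_compose[OF _ borel_measurable_exp] borel_measurable_const) auto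
  have inner: "(\<integral>\<^sup>+p. exp (l * (\<Sum>t<Suc m. X t (fun_upd \<omega> m p))) \<partial>D)
      \<le> exp (l * (\<Sum>t<m. X t \<omega>)) * ennreal (exp (l\<^sup>2 * R\<^sup>2 / 2))" if \<omega>: "\<omega> \<in> space (?P m)" for \<omega>
  proof -
    have res: "restrict (fun_upd \<omega> m p) {..<t} = restrict \<omega> {..<t}" if "t \<le> m" for t p
      using that by (auto simp: restrict_def)
    have ext: "restrict \<omega> {..<m} = \<omega>"
      using \<omega> by (auto simp: space_PiM PiE_def extensional_restrict)
    have Xm: "X t (fun_upd \<omega> m p) = X t \<omega>" if "t < m" for t p
      using that res[of t p] by (simp add: X_def)
    \<comment> \<open>Negating \<open>F\<close> gives the increment the form "variable minus its
      mean" that Hoeffding's lemma expects.\<close>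
    have Xlast: "X m (fun_upd \<omega> m p) = - F m \<omega> p - (\<integral>p. - F m \<omega> p \<partial>D)" for p
      using res[of m p] by (simp add: X_def ext)
    have rv: "(\<lambda>p. - F m \<omega> p) \<in> borel_measurable D"
      using measurable_compose[OF measurable_Pair1'[OF \<omega>] Suc.prems(1)[of m]] by simp
    interpret I: interval_bounded_random_variable D "\<lambda>p. - F m \<omega> p" "- R" R
    proof
      show "(\<lambda>p. - F m \<omega> p) \<in> borel_measurable D" by (fact rv)
      show "AE x in D. - F m \<omega> x \<in> {- R..R}"
        using Suc.prems(2)[OF lessI \<omega>] by (intro AE_I2) (auto simp: abs_le_iff)
    qed
    have "(\<integral>\<^sup>+p. exp (l * (\<Sum>t<Suc m. X t (fun_upd \<omega> m p))) \<partial>D)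
        = (\<integral>\<^sup>+p. ennreal (exp (l * (\<Sum>t<m. X t \<omega>))) *
             ennreal (exp (l * (- F m \<omega> p - (\<integral>p. - F m \<omega> p \<partial>D)))) \<partial>D)"
    proof (intro nn_integral_cong)
      fix p
      have "(\<Sum>t<Suc m. X t (fun_upd \<omega> m p)) = (\<Sum>t<m. X t \<omega>) + (- F m \<omega> p - (\<integral>p. - F m \<omega> p \<partial>D))"
        unfolding sum.lessThan_Suc Xlast by (intro arg_cong2[where f = "(+)"] sum.cong refl Xm) simp
      then show "ennreal (exp (l * (\<Sum>t<Suc m. X t (fun_upd \<omega> m p)))) = ennreal (exp (l * (\<Sum>t<m. X t \<omega>))) *
             ennreal (exp (l * (- F m \<omega> p - (\<integral>p. - F m \<omega> p \<partial>D))))"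
        by (simp only: distrib_left exp_add ennreal_mult' exp_ge_zero)
    qed
    also have "\<dots> = ennreal (exp (l * (\<Sum>t<m. X t \<omega>))) *
             (\<integral>\<^sup>+p. ennreal (exp (l * (- F m \<omega> p - (\<integral>p. - F m \<omega> p \<partial>D)))) \<partial>D)"
      using rv by (intro nn_integral_cmult) measurable
    also have "\<dots> \<le> exp (l * (\<Sum>t<m. X t \<omega>)) * ennreal (exp (l\<^sup>2 * (R - (- R))\<^sup>2 / 8))"
      by (intro mult_left_mono I.Hoeffdings_lemma_nn_integral l) simp
    also have "l\<^sup>2 * (R - (- R))\<^sup>2 / 8 = l\<^sup>2 * R\<^sup>2 / 2" by (simp add: power2_eq_square)
    finally show ?thesis .
  qed
  have "(\<integral>\<^sup>+\<omega>. exp (l * (\<Sum>t<Suc m. X t \<omega>)) \<partial>?P (Suc m))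
      = (\<integral>\<^sup>+\<omega>. \<integral>\<^sup>+p. exp (l * (\<Sum>t<Suc m. X t (fun_upd \<omega> m p))) \<partial>D \<partial>?P m)"
    using product_nn_integral_insert[of "{..<m}" m "\<lambda>\<omega>. ennreal (exp (l * (\<Sum>t<Suc m. X t \<omega>)))"]
      exp_meas[of "Suc m" "Suc m"]
    by (simp only: lessThan_Suc[of m, symmetric] finite_lessThan lessThan_iff less_irrefl order_refl not_False_eq_True simp_thms)
  also have "\<dots> \<le> (\<integral>\<^sup>+\<omega>. exp (l * (\<Sum>t<m. X t \<omega>)) * ennreal (exp (l\<^sup>2 * R\<^sup>2 / 2)) \<partial>?P m)"
    by (intro nn_integral_mono inner)
  also have "\<dots> = (\<integral>\<^sup>+\<omega>. exp (l * (\<Sum>t<m. X t \<omega>)) \<partial>?P m) * ennreal (exp (l\<^sup>2 * R\<^sup>2 / 2))"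
    by (rule nn_integral_multc) (use exp_meas[of m m] in simp)
  also have "\<dots> \<le> ennreal (exp (m * (l\<^sup>2 * R\<^sup>2 / 2))) * ennreal (exp (l\<^sup>2 * R\<^sup>2 / 2))"
    unfolding X_def by (intro mult_right_mono Suc.IH) (use Suc.prems in auto)
  also have "\<dots> = ennreal (exp (Suc m * (l\<^sup>2 * R\<^sup>2 / 2)))"
    by (simp add: ennreal_mult'[symmetric] exp_add[symmetric] algebra_simps)
  finally show ?case unfolding X_def .
qed

lemma azuma_hoeffding_PiM:
  fixes F :: "nat \<Rightarrow> (nat \<Rightarrow> 'a) \<Rightarrow> 'a \<Rightarrow> real"
  assumes D: "prob_space D" and "0 < R" "0 < a" "0 < m"
    and meas: "\<And>t. t < m \<Longrightarrow> case_prod (F t) \<in> borel_measurable (PiM {..<t} (\<lambda>_. D) \<Otimes>\<^sub>M D)"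
    and bound: "\<And>t \<omega> p. t < m \<Longrightarrow> \<omega> \<in> space (PiM {..<t} (\<lambda>_. D)) \<Longrightarrow> p \<in> space D \<Longrightarrow> \<bar>F t \<omega> p\<bar> \<le> R"
  defines "X \<equiv> \<lambda>\<omega>. \<Sum>t<m. (\<integral>p. F t (restrict \<omega> {..<t}) p \<partial>D) - F t (restrict \<omega> {..<t}) (\<omega> t)"
  shows "X \<in> borel_measurable (PiM {..<m} (\<lambda>_. D))"
    and "measure (PiM {..<m} (\<lambda>_. D)) {\<omega> \<in> space (PiM {..<m} (\<lambda>_. D)). real m * a \<le> X \<omega>}
      \<le> exp (- real m * a\<^sup>2 / (2 * R\<^sup>2))"
proof -
  interpret D: prob_space D by fact
  let ?P = "\<lambda>t. PiM {..<t} (\<lambda>_. D)"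
  interpret P: prob_space "?P m" by (rule prob_space_PiM) (rule D)
  show X_meas [measurable]: "X \<in> borel_measurable (?P m)"
    unfolding X_def
  proof (intro borel_measurable_sum borel_measurable_diff)
    fix t assume "t \<in> {..<m}"
    then have t: "t < m" by simp
    note [measurable] = meas[OF t]
    have r: "(\<lambda>\<omega>. restrict \<omega> {..<t}) \<in> ?P m \<rightarrow>\<^sub>M ?P t"
      by (rule measurable_restrict_subset) (use t in auto)
    have c: "(\<lambda>\<omega>. \<omega> t) \<in> ?P m \<rightarrow>\<^sub>M D"
      by (rule measurable_component_singleton) (use t in auto)
    have *: "(\<lambda>\<omega>. \<integral>p. F t \<omega> p \<partial>D) \<in> borel_measurable (?P t)"
      by (rule D.borel_measurable_lebesgue_integral) measurable
    show "(\<lambda>\<omega>. \<integral>p. F t (restrict \<omega> {..<t}) p \<partial>D) \<in> borel_measurable (?P m)"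
      using measurable_compose[OF r *] .
    show "(\<lambda>\<omega>. F t (restrict \<omega> {..<t}) (\<omega> t)) \<in> borel_measurable (?P m)"
      using measurable_compose[OF measurable_Pair[OF r c] meas[OF t]] by simp
  qed
  \<comment> \<open>This \<open>l\<close> minimises
    \<open>l\<^sup>2 * R\<^sup>2 / 2 - l * a\<close>, the Chernoff exponent per round.\<close>
  define l where "l = a / R\<^sup>2"
  have l: "0 < l" using assms by (simp add: l_def)
  have "emeasure (?P m) {\<omega> \<in> space (?P m). real m * a \<le> X \<omega>}
      \<le> ennreal (exp (- l * (m * a))) * (\<integral>\<^sup>+\<omega>. ennreal (exp (l * X \<omega>)) * indicator (space (?P m)) \<omega> \<partial>?P m)"
    by (rule Chernoff_ineq_nn_integral_ge) (use l in auto)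
  also have "(\<integral>\<^sup>+\<omega>. ennreal (exp (l * X \<omega>)) * indicator (space (?P m)) \<omega> \<partial>?P m)
      = (\<integral>\<^sup>+\<omega>. ennreal (exp (l * X \<omega>)) \<partial>?P m)"
    by (intro nn_integral_cong) auto
  also have "\<dots> \<le> ennreal (exp (m * (l\<^sup>2 * R\<^sup>2 / 2)))"
    unfolding X_def by (rule nn_integral_exp_martingale_le[OF D l meas bound])
  also have "ennreal (exp (- l * (m * a))) * ennreal (exp (m * (l\<^sup>2 * R\<^sup>2 / 2))) = ennreal (exp (- real m * a\<^sup>2 / (2 * R\<^sup>2)))"
    using \<open>0 < R\<close> by (simp add: ennreal_mult'[symmetric] exp_add[symmetric] l_def field_simps power2_eq_square)
  finally have "emeasure (?P m) {\<omega> \<in> space (?P m). real m * a \<le> X \<omega>} \<le> exp (- real m * a\<^sup>2 / (2 * R\<^sup>2))"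
    by (simp add: mult_left_mono)
  then show "measure (?P m) {\<omega> \<in> space (?P m). real m * a \<le> X \<omega>} \<le> exp (- real m * a\<^sup>2 / (2 * R\<^sup>2))"
    by (simp only: P.emeasure_eq_measure ennreal_le_iff exp_ge_zero)
qed

section \<open>Total correctness with time bounds\<close>

definition runs ::
  "(real \<Rightarrow> real) \<Rightarrow> nat \<Rightarrow> (nat \<Rightarrow> example) \<Rightarrow> com \<Rightarrow> store \<Rightarrow> nat \<Rightarrow> (store \<Rightarrow> bool) \<Rightarrow> bool" where
  "runs u n \<omega> c s B Q \<longleftrightarrow> (\<exists>t s'. exec u n \<omega> c s t s' \<and> t \<le> B \<and> Q s')"

lemma runs_mono: "runs u n \<omega> c s B Q \<Longrightarrow> B \<le> B' \<Longrightarrow> (\<And>s'. Q s' \<Longrightarrow> Q' s') \<Longrightarrow> runs u n \<omega> c s B' Q'"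
  unfolding runs_def by (meson le_trans)

lemma runs_le: "runs u n \<omega> c s B Q \<Longrightarrow> B \<le> B' \<Longrightarrow> runs u n \<omega> c s B' Q"
  by (rule runs_mono)

lemma runs_ISet: "Q (set_reg r (ival s a) s) \<Longrightarrow> runs u n \<omega> (ISet r a) s (icost a + 1) Q"
  unfolding runs_def by (meson exec_ISet le_refl)

lemma runs_RSet:
  "Q (set_cell k (ival s a) (rval u s e) s) \<Longrightarrow> runs u n \<omega> (RSet k a e) s (icost a + rcost e + 1) Q"
  unfolding runs_def by (meson exec_RSet le_refl)

lemma runs_Draw: "Q (load_example n \<omega> s) \<Longrightarrow> runs u n \<omega> Draw s 1 Q"
  unfolding runs_def by (meson exec_Draw le_refl)

lemma runs_Seq:
  "runs u n \<omega> c1 s B1 (\<lambda>s1. runs u n \<omega> c2 s1 B2 Q) \<Longrightarrow> runs u n \<omega> (Seq c1 c2) s (B1 + B2) Q"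
  unfolding runs_def by (meson exec_Seq add_mono)

text \<open>For a first part such as a loop, whose final store is known only through an assertion
  \<open>R\<close>.\<close>

lemma runs_SeqI:
  assumes "runs u n \<omega> c1 s B1 R" "\<And>s1. R s1 \<Longrightarrow> runs u n \<omega> c2 s1 B2 Q"
  shows "runs u n \<omega> (Seq c1 c2) s (B1 + B2) Q"
  using assms by (intro runs_Seq) (blast intro: runs_mono)

lemma runs_Cond:
  assumes "bval u s b \<Longrightarrow> runs u n \<omega> c1 s B Q" "\<not> bval u s b \<Longrightarrow> runs u n \<omega> c2 s B Q"
  shows "runs u n \<omega> (Cond b c1 c2) s (bcost b + B) Q"
  using assms unfolding runs_def by (meson exec_CondT exec_CondF add_left_mono)

text \<open>The invariant is indexed by the number of completed iterations, of which there are
  exactly \<open>N\<close>; the separate \<open>bcost b\<close> pays for the final failing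
  test.\<close>

lemma runs_While:
  assumes "I 0 s"
    and step: "\<And>j s. I j s \<Longrightarrow> j < N \<Longrightarrow> bval u s b \<and> runs u n \<omega> c s B (I (Suc j))"
    and stop: "\<And>s. I N s \<Longrightarrow> \<not> bval u s b"
  shows "runs u n \<omega> (While b c) s (bcost b + N * (bcost b + B)) (I N)"
proof -
  have "runs u n \<omega> (While b c) s (bcost b + (N - j) * (bcost b + B)) (I N)" if "I j s" "j \<le> N" for j s
    using that(2,1)
  proof (induction j arbitrary: s rule: inc_induct)
    case base
    then show ?case using stop unfolding runs_def by (fastforce intro: exec_WhileF)
  next
    case (step j)
    obtain t1 s1 where 1: "exec u n \<omega> c s t1 s1" "t1 \<le> B" "I (Suc j) s1"
      using assms(2)[OF step.prems step.hyps(2)] unfolding runs_def by blast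
    obtain t2 s2 where 2: "exec u n \<omega> (While b c) s1 t2 s2"
        "t2 \<le> bcost b + (N - Suc j) * (bcost b + B)" "I N s2"
      using step.IH[OF 1(3)] unfolding runs_def by blast
    have "N - j = Suc (N - Suc j)" using step.hyps by simp
    then have "bcost b + t1 + t2 \<le> bcost b + (N - j) * (bcost b + B)"
      using 1(2) 2(2) by simp
    then show ?case
      using assms(2)[OF step.prems step.hyps(2)] exec_WhileT[OF _ 1(1) 2(1)] 2(3)
      unfolding runs_def by blast
  qed
  from this[OF assms(1)] show ?thesis by simp
qed

lemma set_reg_simps [simp]:
  "reg (set_reg r v s) = (reg s)(r := v)" "arr (set_reg r v s) = arr s" "drawn (set_reg r v s) = drawn s"
  by (simp_all add: set_reg_def)

lemma set_cell_simps [simp]: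
  "reg (set_cell k i v s) = reg s" "arr (set_cell k i v s) = (arr s)(k := (arr s k)(i := v))"
  "drawn (set_cell k i v s) = drawn s"
  by (simp_all add: set_cell_def)

lemma load_point_simps [simp]:
  "reg (load_point n x s) = reg s" "arr (load_point n x s) = (arr s)(0 := override_on (arr s 0) x {..<n})"
  "drawn (load_point n x s) = drawn s"
  by (simp_all add: load_point_def)

lemma load_example_simps [simp]:
  "reg (load_example n \<omega> s) = reg s"
  "arr (load_example n \<omega> s) =
     (arr s)(0 := override_on (arr s 0) (fst (\<omega> (drawn s))) {..<n}, 1 := (arr s 1)(0 := snd (\<omega> (drawn s))))"
  "drawn (load_example n \<omega> s) = Suc (drawn s)"
  by (simp_all add: load_example_def)

section \<open>The learning program\<close>

text \<open>
  Register \<open>2\<close> holds the number of coordinates used, \<open>5\<close> the number of rounds, \<open>6\<close> the current round;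
  \<open>7\<close>, \<open>8\<close>, \<open>9\<close> are the past round, the coordinate and the position in array \<open>3\<close> during an
  evaluation. Array \<open>3\<close> holds the points seen so far one after the other, array \<open>4\<close> their residuals,
  cell \<open>7\<close> of array \<open>2\<close> the step size, and array \<open>5\<close> the kernel value, the margin and the sum of
  the predictions of the past rounds.
\<close>

definition kernel_body :: com where
  "kernel_body =
     Seq (RSet 5 (INum 0) (RMul (RGet 5 (INum 0))
            (RAdd (RNat (INum 1)) (RDiv (RMul (RGet 3 (IReg 9)) (RGet 0 (IReg 8))) (RNat (IReg 2))))))
    (Seq (ISet 8 (IAdd (IReg 8) (INum 1))) (ISet 9 (IAdd (IReg 9) (INum 1))))"

text \<open>One pass yields both results: a prediction is added before its round's own term enters
  the margin, so after \<open>N\<close> iterations cell 2 sums the predictions of the rounds below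
  \<open>N\<close> and cell 1 holds the margin of round \<open>N\<close>. Register 9 is not reset
  here, since the points lie contiguously in array 3.\<close>

definition eval_body :: com where
  "eval_body =
     Seq (RSet 5 (INum 2) (RAdd (RGet 5 (INum 2)) (ROracle (RGet 5 (INum 1)))))
    (Seq (RSet 5 (INum 0) (RNat (INum 1)))
    (Seq (ISet 8 (INum 0))
    (Seq (While (ILess (IReg 8) (IReg 2)) kernel_body)
    (Seq (RSet 5 (INum 1) (RSub (RGet 5 (INum 1))
            (RMul (RMul (RGet 2 (INum 7)) (RGet 4 (IReg 7))) (RGet 5 (INum 0)))))
         (ISet 7 (IAdd (IReg 7) (INum 1)))))))"

text \<open>Register \<open>b\<close> is 6 in training, where only past rounds count, and 5 in
  prediction, where all rounds do.\<close>

definition eval_prog :: "nat \<Rightarrow> com" where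
  "eval_prog b =
     Seq (RSet 5 (INum 1) (RNat (INum 0)))
    (Seq (RSet 5 (INum 2) (RNat (INum 0)))
    (Seq (ISet 7 (INum 0))
    (Seq (ISet 9 (INum 0))
         (While (ILess (IReg 7) (IReg b)) eval_body))))"

definition margin :: "real \<Rightarrow> nat \<Rightarrow> (nat \<Rightarrow> real) \<Rightarrow> (nat \<Rightarrow> nat \<Rightarrow> real) \<Rightarrow> nat \<Rightarrow> (nat \<Rightarrow> real) \<Rightarrow> real" where
  "margin \<eta> k c X t x = - (\<Sum>r<t. \<eta> * c r * kernel k (X r) x)"

lemma kernel_cong:
  "(\<And>i. i < k \<Longrightarrow> x i = x' i) \<Longrightarrow> (\<And>i. i < k \<Longrightarrow> y i = y' i) \<Longrightarrow> kernel k x y = kernel k x' y'"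
  unfolding kernel_def by (intro prod.cong) auto

definition frame_eq :: "nat set \<Rightarrow> nat set \<Rightarrow> store \<Rightarrow> store \<Rightarrow> bool" where
  "frame_eq R K s s' \<longleftrightarrow>
     (\<forall>r. r \<notin> R \<longrightarrow> reg s' r = reg s r) \<and> (\<forall>k. k \<notin> K \<longrightarrow> arr s' k = arr s k) \<and> drawn s' = drawn s"

lemma runs_kernel_loop:
  assumes "reg s 2 = k" "reg s 8 = 0" "reg s 9 = p" "arr s 5 0 = 1"
  shows "runs u n \<omega> (While (ILess (IReg 8) (IReg 2)) kernel_body) s (3 + k * 27)
     (\<lambda>s'. frame_eq {8, 9} {5} s s' \<and> reg s' 9 = p + k \<and>
        arr s' 5 = (arr s 5)(0 := kernel k (\<lambda>i. arr s 3 (p + i)) (arr s 0)))"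
proof -
  define I where "I j s' \<longleftrightarrow> frame_eq {8, 9} {5} s s' \<and> reg s' 8 = j \<and> reg s' 9 = p + j \<and>
        arr s' 5 = (arr s 5)(0 := (\<Prod>i<j. 1 + arr s 3 (p + i) * arr s 0 i / k))" for j s'
  let ?b = "ILess (IReg 8) (IReg 2)"
  have "runs u n \<omega> (While ?b kernel_body) s (bcost ?b + k * (bcost ?b + 24)) (I k)"
  proof (rule runs_While)
    show "I 0 s" using assms by (auto simp: I_def frame_eq_def)
    fix j s' assume I: "I j s'" "j < k"
    have "runs u n \<omega> kernel_body s' (16 + (4 + 4)) (I (Suc j))"
      unfolding kernel_body_def
      by (rule runs_le, (rule runs_Seq runs_ISet runs_RSet)+)
         (use I assms in \<open>auto simp: I_def frame_eq_def\<close>)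
    then have "runs u n \<omega> kernel_body s' 24 (I (Suc j))"
      by (rule runs_mono) auto
    then show "bval u s' ?b \<and> runs u n \<omega> kernel_body s' 24 (I (Suc j))"
      using I assms by (auto simp: I_def frame_eq_def)
  qed (use assms in \<open>auto simp: I_def frame_eq_def\<close>)
  then show ?thesis
    by (rule runs_mono) (auto simp: I_def kernel_def)
qed

lemma runs_eval_prog:
  assumes b: "b \<notin> {7, 8, 9}" and s: "reg s 2 = k" "reg s b = N" "arr s 2 7 = \<eta>"
    and c: "\<And>r. r < N \<Longrightarrow> arr s 4 r = c r"
    and X: "\<And>r i. r < N \<Longrightarrow> i < k \<Longrightarrow> arr s 3 (r * k + i) = X r i"
    and x: "\<And>i. i < k \<Longrightarrow> arr s 0 i = x i"
  shows "runs u n \<omega> (eval_prog b) s (15 + N * (43 + 27 * k))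
     (\<lambda>s'. frame_eq {7, 8, 9} {5} s s' \<and> reg s' 9 = N * k \<and>
        arr s' 5 1 = margin \<eta> k c X N x \<and> arr s' 5 2 = (\<Sum>t<N. u (margin \<eta> k c X t x)))"
proof -
  define I where "I j s' \<longleftrightarrow> frame_eq {7, 8, 9} {5} s s' \<and> reg s' 7 = j \<and> reg s' 9 = j * k \<and>
        arr s' 5 1 = margin \<eta> k c X j x \<and> arr s' 5 2 = (\<Sum>t<j. u (margin \<eta> k c X t x))" for j s'
  let ?b = "ILess (IReg 7) (IReg b)" and ?K = "While (ILess (IReg 8) (IReg 2)) kernel_body"
  have I_facts: "reg s1 2 = k" "reg s1 b = N" "arr s1 2 = arr s 2" "arr s1 3 = arr s 3" "arr s1 4 = arr s 4"
      "arr s1 0 = arr s 0" "reg s1 7 = j" "reg s1 9 = j * k" if "I j s1" for j s1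
    using that b s unfolding I_def frame_eq_def by simp_all
  have frame_step: "frame_eq {7, 8, 9} {5} s s2" if "I j s1" "frame_eq {7, 8, 9} {5} s1 s2" for j s1 s2
    using that unfolding I_def frame_eq_def by simp
  have loop: "runs u n \<omega> (While ?b eval_body) s' (bcost ?b + N * (bcost ?b + (40 + 27 * k))) (I N)" if "I 0 s'" for s'
  proof (rule runs_While)
    show "I 0 s'" by (rule that)
    fix j s1 assume I: "I j s1" and j: "j < N"
    have kern: "kernel k (\<lambda>i. arr s 3 (j * k + i)) (arr s 0) = kernel k (X j) x"
      by (intro kernel_cong) (simp_all add: X x j)
    have tail: "runs u n \<omega>
       (Seq (RSet 5 (INum 1) (RSub (RGet 5 (INum 1))
              (RMul (RMul (RGet 2 (INum 7)) (RGet 4 (IReg 7))) (RGet 5 (INum 0)))))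
            (ISet 7 (IAdd (IReg 7) (INum 1)))) s2 (13 + 4) (I (Suc j))"
      if fr: "frame_eq {8, 9} {5} s1 s2" and s2: "reg s2 9 = j * k + k" "arr s2 5 0 = kernel k (X j) x"
        "arr s2 5 (Suc 0) = arr s1 5 (Suc 0)" "arr s2 5 2 = arr s1 5 2 + u (arr s1 5 (Suc 0))" for s2
    proof -
      have s2': "reg s2 7 = j" "arr s2 2 = arr s 2" "arr s2 4 = arr s 4"
        using fr I_facts[OF I] by (simp_all add: frame_eq_def)
      have fr': "frame_eq {7, 8, 9} {5} s s2"
        using I fr by (simp add: I_def frame_eq_def)
      show ?thesis
        by (rule runs_le, rule runs_Seq, rule runs_RSet, rule runs_ISet)
           (use I fr' j in \<open>simp_all add: I_def margin_def frame_eq_def s2 s2' s(3) c\<close>)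
    qed
    \<comment> \<open>The summands are the costs of the statements in order,
      \<open>34 + 27 * k\<close> in total; the bound derived from it leaves some slack.\<close>
    have "runs u n \<omega> eval_body s1 (8 + (4 + (2 + ((3 + k * 27) + (13 + 4))))) (I (Suc j))"
      unfolding eval_body_def
      apply (rule runs_le, rule runs_Seq, rule runs_RSet, rule runs_Seq, rule runs_RSet,
          rule runs_Seq, rule runs_ISet, rule runs_SeqI)
         apply (rule runs_kernel_loop[where p = "j * k" and k = k])
            apply (simp_all add: I_facts[OF I])[4]
       apply (rule tail)
           apply (auto simp: I_facts[OF I] kern frame_eq_def)
      done
    then have "runs u n \<omega> eval_body s1 (40 + 27 * k) (I (Suc j))"
      by (rule runs_mono) auto
    then show "bval u s1 ?b \<and> runs u n \<omega> eval_body s1 (40 + 27 * k) (I (Suc j))"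
      using j by (simp add: I_facts[OF I])
  next
    fix s1 assume "I N s1"
    then show "\<not> bval u s1 ?b" by (simp add: I_facts)
  qed
  show ?thesis
    unfolding eval_prog_def
    apply (rule runs_mono, rule runs_Seq, rule runs_RSet, rule runs_Seq, rule runs_RSet,
        rule runs_Seq, rule runs_ISet, rule runs_Seq, rule runs_ISet, rule loop)
      apply (use b in \<open>auto simp: I_def frame_eq_def margin_def\<close>)
    done
qed

section \<open>Training rounds\<close>

definition copy_body :: com where
  "copy_body = Seq (RSet 3 (IAdd (IReg 9) (IReg 8)) (RGet 0 (IReg 8))) (ISet 8 (IAdd (IReg 8) (INum 1)))"

text \<open>The point is stored only after the evaluation, which leaves register 9 at
  \<open>t * k\<close>, the first free address of array 3.\<close>

definition round_body :: com where
  "round_body =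
     Seq Draw
    (Seq (eval_prog 6)
    (Seq (RSet 4 (IReg 6) (RSub (ROracle (RGet 5 (INum 1))) (RGet 1 (INum 0))))
    (Seq (ISet 8 (INum 0))
    (Seq (While (ILess (IReg 8) (IReg 2)) copy_body)
         (ISet 6 (IAdd (IReg 6) (INum 1)))))))"

definition main_loop :: com where
  "main_loop = While (ILess (IReg 6) (IReg 5)) round_body"

text \<open>The margin is unfolded here because \<open>predictor\<close> is itself defined from
  \<open>residual\<close>; \<open>residual_eq_margin\<close> restores the compact form. As a simp
  rule the equation would loop.\<close>

fun residual :: "(real \<Rightarrow> real) \<Rightarrow> real \<Rightarrow> nat \<Rightarrow> (nat \<Rightarrow> example) \<Rightarrow> nat \<Rightarrow> real" where
  "residual u \<eta> k \<omega> t =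
     u (- (\<Sum>r<t. \<eta> * residual u \<eta> k \<omega> r * kernel k (fst (\<omega> r)) (fst (\<omega> t)))) - snd (\<omega> t)"

declare residual.simps [simp del]

abbreviation predictor :: "(real \<Rightarrow> real) \<Rightarrow> real \<Rightarrow> nat \<Rightarrow> (nat \<Rightarrow> example) \<Rightarrow> nat \<Rightarrow> (nat \<Rightarrow> real) \<Rightarrow> real" where
  "predictor u \<eta> k \<omega> \<equiv> margin \<eta> k (residual u \<eta> k \<omega>) (\<lambda>r. fst (\<omega> r))"

lemma residual_eq_margin:
  "residual u \<eta> k \<omega> t = u (predictor u \<eta> k \<omega> t (fst (\<omega> t))) - snd (\<omega> t)"
  by (subst residual.simps) (simp add: margin_def)

lemma runs_copy_loop:
  assumes "reg s 2 = k" "reg s 8 = 0" "reg s 9 = p"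
  shows "runs u n \<omega> (While (ILess (IReg 8) (IReg 2)) copy_body) s (3 + k * 13)
     (\<lambda>s'. frame_eq {8} {3} s s' \<and>
        arr s' 3 = (\<lambda>a. if p \<le> a \<and> a < p + k then arr s 0 (a - p) else arr s 3 a))"
proof -
  define I where "I j s' \<longleftrightarrow> frame_eq {8} {3} s s' \<and> reg s' 8 = j \<and>
        arr s' 3 = (\<lambda>a. if p \<le> a \<and> a < p + j then arr s 0 (a - p) else arr s 3 a)" for j s'
  let ?b = "ILess (IReg 8) (IReg 2)"
  have "runs u n \<omega> (While ?b copy_body) s (bcost ?b + k * (bcost ?b + 10)) (I k)"
  proof (rule runs_While)
    show "I 0 s" using assms by (auto simp: I_def frame_eq_def fun_eq_iff)
    fix j s' assume I: "I j s'" "j < k"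
    have "runs u n \<omega> copy_body s' 10 (I (Suc j))"
      unfolding copy_body_def
      by (rule runs_le, (rule runs_Seq runs_ISet runs_RSet)+)
         (use I assms in \<open>auto simp: I_def frame_eq_def fun_eq_iff\<close>)
    then show "bval u s' ?b \<and> runs u n \<omega> copy_body s' 10 (I (Suc j))"
      using I assms by (auto simp: I_def frame_eq_def)
  qed (use assms in \<open>auto simp: I_def frame_eq_def\<close>)
  then show ?thesis
    by (rule runs_mono) (auto simp: I_def)
qed

text \<open>The loop invariant after \<open>t\<close> rounds: the setup establishes it for
  \<open>t = 0\<close>, and prediction starts from \<open>t = N\<close>.\<close>

definition trained ::
  "(real \<Rightarrow> real) \<Rightarrow> real \<Rightarrow> nat \<Rightarrow> (nat \<Rightarrow> example) \<Rightarrow> nat \<Rightarrow> nat \<Rightarrow> store \<Rightarrow> bool" where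
  "trained u \<eta> k \<omega> N t s \<longleftrightarrow> reg s 2 = k \<and> reg s 5 = N \<and> reg s 6 = t \<and> drawn s = t \<and> arr s 2 7 = \<eta> \<and>
     (\<forall>r<t. arr s 4 r = residual u \<eta> k \<omega> r) \<and> (\<forall>r<t. \<forall>i<k. arr s 3 (r * k + i) = fst (\<omega> r) i)"

lemma runs_main_loop:
  assumes "k \<le> n" "trained u \<eta> k \<omega> N 0 s"
  shows "runs u n \<omega> main_loop s (3 + N * (36 + 13 * k + N * (43 + 27 * k))) (trained u \<eta> k \<omega> N N)"
proof -
  let ?b = "ILess (IReg 6) (IReg 5)"
  have "runs u n \<omega> main_loop s (bcost ?b + N * (bcost ?b + (33 + 13 * k + N * (43 + 27 * k))))
      (trained u \<eta> k \<omega> N N)"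
    unfolding main_loop_def
  proof (rule runs_While[where I = "trained u \<eta> k \<omega> N"])
    show "trained u \<eta> k \<omega> N 0 s" by (rule assms)
    fix t s1 assume s1: "trained u \<eta> k \<omega> N t s1" and t: "t < N"
    define s2 where "s2 = load_example n \<omega> s1"
    have s2: "reg s2 2 = k" "reg s2 5 = N" "reg s2 6 = t" "drawn s2 = Suc t" "arr s2 2 7 = \<eta>"
        "\<And>r. r < t \<Longrightarrow> arr s2 4 r = residual u \<eta> k \<omega> r"
        "\<And>r i. r < t \<Longrightarrow> i < k \<Longrightarrow> arr s2 3 (r * k + i) = fst (\<omega> r) i"
        "\<And>i. i < k \<Longrightarrow> arr s2 0 i = fst (\<omega> t) i" "arr s2 (Suc 0) 0 = snd (\<omega> t)"
      using s1 assms(1) unfolding trained_def s2_def by (auto simp: override_on_def)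
    let ?m = "predictor u \<eta> k \<omega> t (fst (\<omega> t))"
    have tail: "runs u n \<omega>
       (Seq (RSet 4 (IReg 6) (RSub (ROracle (RGet 5 (INum 1))) (RGet 1 (INum 0))))
       (Seq (ISet 8 (INum 0))
       (Seq (While (ILess (IReg 8) (IReg 2)) copy_body)
         (ISet 6 (IAdd (IReg 6) (INum 1)))))) s3 (17 + 13 * k) (trained u \<eta> k \<omega> N (Suc t))"
      if fr: "frame_eq {7, 8, 9} {5} s2 s3" and s3: "reg s3 9 = t * k" "arr s3 5 (Suc 0) = ?m" for s3
    proof -
      have s3': "reg s3 2 = k" "reg s3 5 = N" "reg s3 6 = t" "drawn s3 = Suc t" "arr s3 2 = arr s2 2"
        "arr s3 4 = arr s2 4" "arr s3 3 = arr s2 3" "arr s3 0 = arr s2 0" "arr s3 (Suc 0) = arr s2 (Suc 0)"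
        using fr s2(1-4) by (simp_all add: frame_eq_def)
      have last: "runs u n \<omega> (ISet 6 (IAdd (IReg 6) (INum 1))) s4 4 (trained u \<eta> k \<omega> N (Suc t))"
        if s4': "reg s4 2 = k" "reg s4 5 = N" "reg s4 6 = t" "drawn s4 = Suc t" "arr s4 2 = arr s2 2"
          "arr s4 4 = (arr s2 4)(t := u ?m - snd (\<omega> t))"
          and s4: "arr s4 3 = (\<lambda>a. if t * k \<le> a \<and> a < t * k + k then arr s3 0 (a - t * k) else arr s3 3 a)"
        for s4
      proof -
        have "arr s4 3 (r * k + i) = fst (\<omega> r) i" if "r < Suc t" "i < k" for r i
        proof (cases "r = t")
          case True
          then show ?thesis using that by (simp add: s4 s3' s2)
        next
          case False
          \<comment> \<open>Point \<open>r\<close> ends before address \<open>Suc r * k\<close>,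
            hence before the block of point \<open>t\<close>, and is not overwritten.\<close>
          then have "Suc r * k \<le> t * k" using that by (intro mult_le_mono1) simp
          then show ?thesis using that False by (simp add: s4 s3' s2)
        qed
        moreover have "arr s4 4 r = residual u \<eta> k \<omega> r" if "r < Suc t" for r
          using that by (cases "r = t") (simp_all add: s4' s2 residual_eq_margin[symmetric])
        ultimately have "trained u \<eta> k \<omega> N (Suc t) (set_reg 6 (ival s4 (IAdd (IReg 6) (INum 1))) s4)"
          by (simp add: trained_def s4' s2)
        then show ?thesis by (rule runs_le[OF runs_ISet]) simp
      qed
      show ?thesis
        apply (rule runs_le, rule runs_Seq, rule runs_RSet, rule runs_Seq, rule runs_ISet,
            rule runs_SeqI, rule runs_copy_loop[where p = "t * k" and k = k])
            apply (simp_all add: s3 s3')[3]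
         apply (rule last; simp add: frame_eq_def s3 s3' s2 cong: if_cong)
        apply simp
        done
    qed
    have "runs u n \<omega> round_body s1 (1 + (15 + t * (43 + 27 * k) + (17 + 13 * k))) (trained u \<eta> k \<omega> N (Suc t))"
      unfolding round_body_def
      apply (rule runs_Seq, rule runs_Draw, fold s2_def, rule runs_SeqI,
          rule runs_eval_prog[where c = "residual u \<eta> k \<omega>" and X = "\<lambda>r. fst (\<omega> r)" and x = "fst (\<omega> t)"])
             apply (simp_all add: s2)[7]
       apply (rule tail; simp)
      done
    \<comment> \<open>The evaluation in round \<open>t\<close> visits \<open>t\<close> past rounds;
      replacing \<open>t\<close> by \<open>N\<close> gives the uniform bound that
      \<open>runs_While\<close> requires.\<close>
    then have "runs u n \<omega> round_body s1 (33 + 13 * k + N * (43 + 27 * k)) (trained u \<eta> k \<omega> N (Suc t))"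
      by (rule runs_le) (use t mult_le_mono1[of t N "43 + 27 * k"] in linarith)
    then show "bval u s1 ?b \<and> runs u n \<omega> round_body s1 (33 + 13 * k + N * (43 + 27 * k)) (trained u \<eta> k \<omega> N (Suc t))"
      using s1 t by (simp add: trained_def)
  qed (simp add: trained_def)
  then show ?thesis by (rule runs_le) simp
qed

section \<open>Parameters of the algorithm and their computation\<close>

definition log_bound :: "real \<Rightarrow> nat" where
  "log_bound \<delta> = (LEAST k. 1 \<le> 2 ^ k * \<delta>)"

text \<open>
  Below, \<open>\<epsilon> * radius\<close> is the total step length \<open>\<eta> * N\<close>, so that the margins stay within
  \<open>4 * \<epsilon> * radius\<close> of the low-degree part of \<open>f\<close>. The number \<open>N\<close> of rounds is chosen such that the
  Azuma--Hoeffding tail \<open>exp (- N / (32 * radius\<^sup>2))\<close> is at most \<open>\<delta>\<close>.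
\<close>

definition radius :: "nat \<Rightarrow> nat \<Rightarrow> real \<Rightarrow> real \<Rightarrow> real" where
  "radius n d M \<epsilon> = M * M * weight n d / (\<epsilon> * \<epsilon>) + 1"

definition rounds :: "nat \<Rightarrow> nat \<Rightarrow> real \<Rightarrow> real \<Rightarrow> real \<Rightarrow> nat" where
  "rounds n d M \<epsilon> \<delta> = nat \<lceil>32 * radius n d M \<epsilon> * radius n d M \<epsilon> * real (log_bound \<delta> + 1)\<rceil>"

definition step_size :: "nat \<Rightarrow> nat \<Rightarrow> real \<Rightarrow> real \<Rightarrow> real \<Rightarrow> real" where
  "step_size n d M \<epsilon> \<delta> = \<epsilon> * radius n d M \<epsilon> / real (rounds n d M \<epsilon> \<delta>)"

text \<open>
  Array \<open>2\<close> during the setup: cell \<open>4\<close> is the weight, \<open>5\<close> the power of two, \<open>6\<close> the real lower bound on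
  the number of rounds and \<open>8\<close> the radius. The reals cannot be rounded, so the number of rounds and the
  logarithm are found by counting.
\<close>

definition weight_loop :: com where
  "weight_loop =
     While (BAnd (ILess (IReg 3) (IReg 1)) (ILess (INum 1) (IReg 0)))
       (Seq (RSet 2 (INum 4) (RMul (RGet 2 (INum 4)) (RNat (IReg 0)))) (ISet 3 (IAdd (IReg 3) (INum 1))))"

definition log_loop :: com where
  "log_loop =
     While (RLess (RMul (RGet 2 (INum 5)) (RGet 2 (INum 3))) (RNat (INum 1)))
       (Seq (RSet 2 (INum 5) (RAdd (RGet 2 (INum 5)) (RGet 2 (INum 5)))) (ISet 4 (IAdd (IReg 4) (INum 1))))"

definition count_loop :: com where
  "count_loop = While (RLess (RNat (IReg 5)) (RGet 2 (INum 6))) (ISet 5 (IAdd (IReg 5) (INum 1)))"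

definition setup_prog :: com where
  "setup_prog =
     Seq (Cond (ILess (INum 0) (IReg 1)) (ISet 2 (IReg 0)) (ISet 2 (INum 0)))
    (Seq (RSet 2 (INum 4) (RNat (INum 1)))
    (Seq weight_loop
    (Seq (RSet 2 (INum 5) (RNat (INum 1)))
    (Seq log_loop
    (Seq (RSet 2 (INum 8) (RAdd (RDiv (RMul (RMul (RGet 2 (INum 0)) (RGet 2 (INum 0))) (RGet 2 (INum 4)))
            (RMul (RGet 2 (INum 2)) (RGet 2 (INum 2)))) (RNat (INum 1))))
    (Seq (RSet 2 (INum 6) (RMul (RMul (RMul (RNat (INum 32)) (RGet 2 (INum 8))) (RGet 2 (INum 8)))
            (RNat (IAdd (IReg 4) (INum 1)))))
    (Seq count_loop
         (RSet 2 (INum 7) (RDiv (RMul (RGet 2 (INum 2)) (RGet 2 (INum 8))) (RNat (IReg 5)))))))))))"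

lemma runs_weight_loop:
  assumes "reg s 0 = n" "reg s 1 = d" "reg s 3 = 0" "arr s 2 4 = 1"
  shows "runs u n' \<omega> weight_loop s (7 + (if n \<le> 1 then 0 else d) * 18)
     (\<lambda>s'. frame_eq {3} {2} s s' \<and> arr s' 2 = (arr s 2)(4 := weight n d))"
proof -
  define I where "I j s' \<longleftrightarrow> frame_eq {3} {2} s s' \<and> reg s' 3 = j \<and> arr s' 2 = (arr s 2)(4 := real n ^ j)" for j s'
  let ?N = "if n \<le> 1 then 0 else d"
  let ?b = "BAnd (ILess (IReg 3) (IReg 1)) (ILess (INum 1) (IReg 0))"
  have "runs u n' \<omega> weight_loop s (bcost ?b + ?N * (bcost ?b + 11)) (I ?N)"
    unfolding weight_loop_def
  proof (rule runs_While)
    show "I 0 s" using assms by (auto simp: I_def frame_eq_def fun_eq_iff)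
    fix j s' assume I: "I j s'" and j: "j < ?N"
    have "runs u n' \<omega> (Seq (RSet 2 (INum 4) (RMul (RGet 2 (INum 4)) (RNat (IReg 0))))
        (ISet 3 (IAdd (IReg 3) (INum 1)))) s' 11 (I (Suc j))"
      by (rule runs_le, (rule runs_Seq runs_ISet runs_RSet)+)
         (use I assms in \<open>auto simp: I_def frame_eq_def fun_eq_iff\<close>)
    then show "bval u s' ?b \<and> runs u n' \<omega> (Seq (RSet 2 (INum 4) (RMul (RGet 2 (INum 4)) (RNat (IReg 0))))
        (ISet 3 (IAdd (IReg 3) (INum 1)))) s' 11 (I (Suc j))"
      using I j assms by (auto simp: I_def frame_eq_def split: if_splits)
  qed (use assms in \<open>auto simp: I_def frame_eq_def\<close>)
  then show ?thesis
    by (rule runs_mono) (auto simp: I_def weight_def)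
qed

lemma log_bound_exists:
  assumes "0 < \<delta>"
  shows "\<exists>k. 1 \<le> 2 ^ k * (\<delta> :: real)"
proof -
  obtain k where "1 / \<delta> < 2 ^ k" using real_arch_pow[of 2 "1 / \<delta>"] by auto
  then show ?thesis using assms by (intro exI[of _ k]) (simp add: field_simps)
qed

text \<open>Doubling replaces a logarithm: minimality in \<open>log_bound\<close> keeps the guard
  true at every earlier count.\<close>

lemma runs_log_loop:
  assumes "arr s 2 3 = \<delta>" "reg s 4 = 0" "arr s 2 5 = 1" "0 < \<delta>"
  shows "runs u n \<omega> log_loop s (8 + log_bound \<delta> * 19)
     (\<lambda>s'. frame_eq {4} {2} s s' \<and> reg s' 4 = log_bound \<delta> \<and> arr s' 2 = (arr s 2)(5 := 2 ^ log_bound \<delta>))"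
proof -
  define I where "I j s' \<longleftrightarrow> frame_eq {4} {2} s s' \<and> reg s' 4 = j \<and> arr s' 2 = (arr s 2)(5 := 2 ^ j)" for j s'
  let ?N = "log_bound \<delta>"
  let ?b = "RLess (RMul (RGet 2 (INum 5)) (RGet 2 (INum 3))) (RNat (INum 1))"
  let ?c = "Seq (RSet 2 (INum 5) (RAdd (RGet 2 (INum 5)) (RGet 2 (INum 5)))) (ISet 4 (IAdd (IReg 4) (INum 1)))"
  have "runs u n \<omega> log_loop s (bcost ?b + ?N * (bcost ?b + 11)) (I ?N)"
    unfolding log_loop_def
  proof (rule runs_While)
    show "I 0 s" using assms by (auto simp: I_def frame_eq_def fun_eq_iff)
  next
    fix j s' assume I: "I j s'" and j: "j < ?N"
    have "2 ^ j * \<delta> < 1"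
      using not_less_Least[of j "\<lambda>k. 1 \<le> 2 ^ k * \<delta>"] j by (simp add: log_bound_def)
    moreover have "runs u n \<omega> ?c s' 11 (I (Suc j))"
      by (rule runs_le, (rule runs_Seq runs_ISet runs_RSet)+)
         (use I assms in \<open>auto simp: I_def frame_eq_def fun_eq_iff\<close>)
    ultimately show "bval u s' ?b \<and> runs u n \<omega> ?c s' 11 (I (Suc j))"
      using I j assms by (auto simp: I_def frame_eq_def)
  next
    fix s' assume "I ?N s'"
    moreover have "1 \<le> 2 ^ ?N * \<delta>"
      unfolding log_bound_def using log_bound_exists[OF \<open>0 < \<delta>\<close>] by (rule LeastI_ex)
    ultimately show "\<not> bval u s' ?b" using assms by (auto simp: I_def frame_eq_def)
  qed
  then show ?thesis
    by (rule runs_mono) (auto simp: I_def)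
qed

text \<open>A ceiling computed by counting. Its time is proportional to the result, here the number
  of rounds that are run anyway.\<close>

lemma runs_count_loop:
  assumes "arr s 2 6 = a" "reg s 5 = 0"
  shows "runs u n \<omega> count_loop s (5 + nat \<lceil>a\<rceil> * 9) (\<lambda>s'. frame_eq {5} {} s s' \<and> reg s' 5 = nat \<lceil>a\<rceil>)"
proof -
  define I where "I j s' \<longleftrightarrow> frame_eq {5} {} s s' \<and> reg s' 5 = j" for j s'
  let ?b = "RLess (RNat (IReg 5)) (RGet 2 (INum 6))"
  have "runs u n \<omega> count_loop s (bcost ?b + nat \<lceil>a\<rceil> * (bcost ?b + 4)) (I (nat \<lceil>a\<rceil>))"
    unfolding count_loop_def
  proof (rule runs_While)
    show "I 0 s" using assms by (auto simp: I_def frame_eq_def)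
  next
    fix j s' assume I: "I j s'" and j: "j < nat \<lceil>a\<rceil>"
    have "runs u n \<omega> (ISet 5 (IAdd (IReg 5) (INum 1))) s' 4 (I (Suc j))"
      by (rule runs_le, rule runs_ISet) (use I in \<open>auto simp: I_def frame_eq_def\<close>)
    moreover have "real j < a" using j by linarith
    ultimately show "bval u s' ?b \<and> runs u n \<omega> (ISet 5 (IAdd (IReg 5) (INum 1))) s' 4 (I (Suc j))"
      using I assms by (auto simp: I_def frame_eq_def)
  next
    fix s' assume "I (nat \<lceil>a\<rceil>) s'"
    then show "\<not> bval u s' ?b" using assms real_nat_ceiling_ge[of a] by (auto simp: I_def frame_eq_def)
  qed
  then show ?thesis
    by (rule runs_mono) (auto simp: I_def)
qed

lemma init_store_simps [simp]:
  "reg (init_store n d M L \<epsilon> \<delta>) = (\<lambda>_. 0)(0 := n, 1 := d)"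
  "arr (init_store n d M L \<epsilon> \<delta>) = (\<lambda>_ _. 0)(2 := (\<lambda>_. 0)(0 := M, 1 := L, 2 := \<epsilon>, 3 := \<delta>))"
  "drawn (init_store n d M L \<epsilon> \<delta>) = 0"
  by (simp_all add: init_store_def)

lemma runs_setup:
  assumes "0 < \<delta>"
  shows "runs u n \<omega> setup_prog (init_store n d M L \<epsilon> \<delta>)
     (100 + 18 * (if n \<le> 1 then 0 else d) + 19 * log_bound \<delta> + 9 * rounds n d M \<epsilon> \<delta>)
     (trained u (step_size n d M \<epsilon> \<delta>) (eff_dim n d) \<omega> (rounds n d M \<epsilon> \<delta>) 0)"
proof -
  let ?T = "trained u (step_size n d M \<epsilon> \<delta>) (eff_dim n d) \<omega> (rounds n d M \<epsilon> \<delta>) 0"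
  let ?A = "radius n d M \<epsilon>"
  \<comment> \<open>\<open>st\<close> collects the facts about the store that survive the setup
    loops; the suffixes \<open>c2\<close> and \<open>c3\<close> of the setup are verified separately
    from it.\<close>
  define st where "st s \<longleftrightarrow> reg s 2 = eff_dim n d \<and> reg s 5 = 0 \<and> reg s 6 = 0 \<and> drawn s = 0 \<and>
      arr s 2 0 = M \<and> arr s 2 2 = \<epsilon> \<and> arr s 2 3 = \<delta>" for s :: store
  define c3 where "c3 =
     Seq (RSet 2 (INum 8) (RAdd (RDiv (RMul (RMul (RGet 2 (INum 0)) (RGet 2 (INum 0))) (RGet 2 (INum 4)))
            (RMul (RGet 2 (INum 2)) (RGet 2 (INum 2)))) (RNat (INum 1))))
    (Seq (RSet 2 (INum 6) (RMul (RMul (RMul (RNat (INum 32)) (RGet 2 (INum 8))) (RGet 2 (INum 8)))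
            (RNat (IAdd (IReg 4) (INum 1)))))
    (Seq count_loop
         (RSet 2 (INum 7) (RDiv (RMul (RGet 2 (INum 2)) (RGet 2 (INum 8))) (RNat (IReg 5))))))"
  define c2 where "c2 = Seq (RSet 2 (INum 5) (RNat (INum 1))) (Seq log_loop c3)"
  have 3: "runs u n \<omega> c3 s (55 + 9 * rounds n d M \<epsilon> \<delta>) ?T"
    if "st s" and w: "arr s 2 4 = weight n d" and l: "reg s 4 = log_bound \<delta>" for s
    unfolding c3_def
    apply (rule runs_le, rule runs_Seq, rule runs_RSet, rule runs_Seq, rule runs_RSet, rule runs_SeqI,
        rule runs_count_loop[where a = "32 * ?A * ?A * real (log_bound \<delta> + 1)"])
        apply (use that in \<open>simp_all add: st_def radius_def\<close>)[2]
     apply (rule runs_RSet)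
     apply (use that in \<open>simp add: st_def trained_def frame_eq_def step_size_def rounds_def radius_def\<close>)
    apply (simp add: rounds_def)
    done
  have 2: "runs u n \<omega> c2 s (70 + 19 * log_bound \<delta> + 9 * rounds n d M \<epsilon> \<delta>) ?T"
    if "st s" and w: "arr s 2 4 = weight n d" and l: "reg s 4 = 0" for s
    unfolding c2_def
    apply (rule runs_le, rule runs_Seq, rule runs_RSet, rule runs_SeqI, rule runs_log_loop[where \<delta> = \<delta>])
         apply (use that assms in \<open>simp_all add: st_def\<close>)[4]
     apply (rule 3)
       apply (use that in \<open>simp_all add: st_def frame_eq_def\<close>)
    done
  show ?thesis
    unfolding setup_prog_def c3_def[symmetric] c2_def[symmetric]
    apply (rule runs_le, rule runs_SeqI[where R = "\<lambda>s. s = set_reg 2 (eff_dim n d) (init_store n d M L \<epsilon> \<delta>)"])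
      apply (rule runs_Cond[where B = 2]; (rule runs_le, rule runs_ISet))
           apply (simp_all add: eff_dim_def)[4]
     apply (rule runs_Seq, rule runs_RSet, rule runs_SeqI, rule runs_weight_loop[where n = n and d = d])
         apply (simp_all)[4]
     apply (rule 2)
       apply (simp_all add: st_def frame_eq_def)
    done
qed

section \<open>The complete learner and its running time\<close>

definition train_prog :: com where
  "train_prog = Seq setup_prog main_loop"

definition predict_prog :: com where
  "predict_prog = Seq (eval_prog 5) (RSet 1 (INum 0) (RDiv (RGet 5 (INum 2)) (RNat (IReg 5))))"

text \<open>Setup, main loop and one prediction added up, so that the same number bounds both
  programs; \<open>125\<close> is \<open>100 + 3\<close> for the first two and \<open>22\<close> for
  the last.\<close>

definition time_bound :: "nat \<Rightarrow> nat \<Rightarrow> real \<Rightarrow> real \<Rightarrow> real \<Rightarrow> nat" where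
  "time_bound n d M \<epsilon> \<delta> = (let N = rounds n d M \<epsilon> \<delta>; k = eff_dim n d in
     125 + 18 * (if n \<le> 1 then 0 else d) + 19 * log_bound \<delta> + 9 * N + N * (36 + 13 * k + N * (43 + 27 * k)) + N * (43 + 27 * k))"

definition learned_hyp ::
  "(real \<Rightarrow> real) \<Rightarrow> real \<Rightarrow> nat \<Rightarrow> nat \<Rightarrow> (nat \<Rightarrow> example) \<Rightarrow> (nat \<Rightarrow> real) \<Rightarrow> real" where
  "learned_hyp u \<eta> k N \<omega> x = (\<Sum>t<N. u (predictor u \<eta> k \<omega> t x)) / N"

lemma outputs_learned_hyp:
  assumes "0 < \<delta>" "real (time_bound n d M \<epsilon> \<delta>) \<le> T"
  shows "outputs_hyp (train_prog, predict_prog) u n d M L \<epsilon> \<delta> \<omega> (rounds n d M \<epsilon> \<delta>) T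
     (learned_hyp u (step_size n d M \<epsilon> \<delta>) (eff_dim n d) (rounds n d M \<epsilon> \<delta>) \<omega>)"
proof -
  let ?k = "eff_dim n d" and ?N = "rounds n d M \<epsilon> \<delta>" and ?\<eta> = "step_size n d M \<epsilon> \<delta>"
  have k: "?k \<le> n" by (simp add: eff_dim_def)
  have "runs u n \<omega> train_prog (init_store n d M L \<epsilon> \<delta>) (time_bound n d M \<epsilon> \<delta>) (trained u ?\<eta> ?k \<omega> ?N ?N)"
    unfolding train_prog_def
    by (rule runs_le, rule runs_SeqI[OF runs_setup[OF assms(1)] runs_main_loop[OF k]], assumption)
       (simp add: time_bound_def Let_def)
  then obtain t s where train: "exec u n \<omega> train_prog (init_store n d M L \<epsilon> \<delta>) t s"
      "t \<le> time_bound n d M \<epsilon> \<delta>" and s: "trained u ?\<eta> ?k \<omega> ?N ?N s"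
    unfolding runs_def by blast
  have "runs u n \<omega> predict_prog (load_point n x s) (time_bound n d M \<epsilon> \<delta>)
      (\<lambda>s'. drawn s' = ?N \<and> arr s' 1 0 = learned_hyp u ?\<eta> ?k ?N \<omega> x)" for x
    unfolding predict_prog_def
    apply (rule runs_le, rule runs_SeqI,
      rule runs_eval_prog[where c = "residual u ?\<eta> ?k \<omega>" and X = "\<lambda>r. fst (\<omega> r)" and x = x and N = ?N and k = ?k])
            apply (use s k in \<open>auto simp: trained_def override_on_def\<close>)[7]
     apply (rule runs_RSet)
     apply (use s in \<open>simp add: frame_eq_def trained_def learned_hyp_def\<close>)
    apply (simp add: time_bound_def Let_def)
    done
  then have "\<exists>t' s'. exec u n \<omega> predict_prog (load_point n x s) t' s' \<and> drawn s' = ?N \<and> real t' \<le> T \<and>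
      arr s' 1 0 = learned_hyp u ?\<eta> ?k ?N \<omega> x" for x
    using assms(2) unfolding runs_def by (meson of_nat_le_iff order_trans)
  moreover have "drawn s = ?N" "real t \<le> T"
    using s train(2) assms(2) by (auto simp: trained_def)
  ultimately show ?thesis
    unfolding outputs_hyp_def fst_conv snd_conv using train(1) by blast
qed

section \<open>Error of the learned hypothesis\<close>

context
  fixes n :: nat and D :: "example measure"
  assumes D: "uniform_marginal_dist n D"
begin

lemma prob_space_examples: "prob_space D"
  using D by (simp add: uniform_marginal_dist_def)

lemma sets_examples: "sets D = sets (example_space n)"
  using D by (simp add: uniform_marginal_dist_def)

lemma space_examples: "space D = cube n \<times> {0..1}"
  using sets_eq_imp_space_eq[OF sets_examples]
  by (simp add: example_space_def space_pair_measure)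

lemma measurable_fst_examples: "fst \<in> D \<rightarrow>\<^sub>M count_space (cube n)"
  by (simp add: measurable_cong_sets[OF sets_examples refl] example_space_def)

lemma measurable_point [measurable (raw)]:
  fixes g :: "(nat \<Rightarrow> real) \<Rightarrow> real"
  assumes "h \<in> N \<rightarrow>\<^sub>M D"
  shows "(\<lambda>z. g (fst (h z))) \<in> borel_measurable N"
  by (rule measurable_compose[OF measurable_compose[OF assms measurable_fst_examples]]) simp

lemma measurable_label [measurable (raw)]:
  assumes "h \<in> N \<rightarrow>\<^sub>M D"
  shows "(\<lambda>z. snd (h z)) \<in> borel_measurable N"
proof -
  have "snd \<in> example_space n \<rightarrow>\<^sub>M restrict_space borel {0..1::real}"
    by (simp add: example_space_def)
  then have "snd \<in> borel_measurable D"
    by (simp add: measurable_cong_sets[OF sets_examples refl] measurable_restrict_space2_iff)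
  then show ?thesis using measurable_compose[OF assms] by blast
qed

lemma expectation_point: "(\<integral>p. g (fst p) \<partial>D) = cube_avg n g"
proof -
  have "(\<integral>p. g (fst p) \<partial>D) = (\<integral>x. g x \<partial>distr D (count_space (cube n)) fst)"
    by (rule integral_distr[symmetric]) (simp_all add: measurable_fst_examples)
  also have "\<dots> = cube_avg n g"
    using D by (simp add: uniform_marginal_dist_def cube_avg_eq_integral)
  finally show ?thesis .
qed

lemma integrable_examples:
  assumes "g \<in> borel_measurable D" "\<And>p. p \<in> space D \<Longrightarrow> \<bar>g p\<bar> \<le> b"
  shows "integrable D (g :: example \<Rightarrow> real)"
proof -
  interpret prob_space D by (rule prob_space_examples)
  show ?thesis
    by (rule integrable_const_bound[of _ b]) (use assms in auto)
qed

text \<open>The cube is finite, so any real function on it is bounded; this gives integrability for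
  arbitrary \<open>g\<close> below.\<close>

lemma point_bound: "p \<in> space D \<Longrightarrow> \<bar>g (fst p) :: real\<bar> \<le> (\<Sum>x\<in>cube n. \<bar>g x\<bar>)"
  using member_le_sum[of "fst p" "cube n" "\<lambda>x. \<bar>g x\<bar>"] by (auto simp: space_examples)

lemma integrable_point: "integrable D (\<lambda>p. g (fst p) :: real)"
  by (rule integrable_examples[OF _ point_bound]) simp

lemma integrable_point_label: "integrable D (\<lambda>p. g (fst p) * snd p)"
proof (rule integrable_examples)
  fix p assume p: "p \<in> space D"
  have "\<bar>g (fst p) * snd p\<bar> \<le> \<bar>g (fst p)\<bar> * 1"
    unfolding abs_mult using p by (intro mult_left_mono) (auto simp: space_examples)
  then show "\<bar>g (fst p) * snd p\<bar> \<le> (\<Sum>x\<in>cube n. \<bar>g x\<bar>)"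
    using point_bound[OF p, of g] by simp
qed simp

text \<open>Prerequisites for using the characteristic property of \<open>real_cond_exp\<close> with
  respect to the point.\<close>

lemma label_algebra:
  defines "F \<equiv> vimage_algebra (space D) fst (count_space (cube n))"
  shows "finite_measure_subalgebra D F" "(\<lambda>p. g (fst p)) \<in> borel_measurable F"
proof -
  interpret prob_space D by (rule prob_space_examples)
  have fst_D: "fst \<in> space D \<rightarrow> space (count_space (cube n))"
    using measurable_space[OF measurable_fst_examples] by simp
  have "subalgebra D F"
    unfolding subalgebra_def F_def
    using measurable_sets[OF measurable_fst_examples] fst_D
    by (auto simp: sets_vimage_algebra2)
  then show "finite_measure_subalgebra D F"
    by unfold_locales
  show "(\<lambda>p. g (fst p)) \<in> borel_measurable F"
    unfolding F_def by (rule measurable_compose[OF measurable_vimage_algebra1[OF fst_D]]) simp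
qed

lemma measurable_label_mean: "label_mean n D \<in> borel_measurable D"
proof -
  interpret finite_measure_subalgebra D "vimage_algebra (space D) fst (count_space (cube n))"
    by (rule label_algebra)
  show ?thesis unfolding label_mean_def by simp
qed

text \<open>The factor \<open>g (fst p)\<close> is measurable for the conditioning algebra, so the
  label may be replaced by its conditional mean under the integral.\<close>

lemma expectation_point_label:
  assumes "AE p in D. label_mean n D p = b (fst p)"
  shows "(\<integral>p. g (fst p) * snd p \<partial>D) = cube_avg n (\<lambda>x. g x * b x)"
proof -
  interpret finite_measure_subalgebra D "vimage_algebra (space D) fst (count_space (cube n))"
    by (rule label_algebra)
  note [measurable] = measurable_label_mean
  have "(\<integral>p. g (fst p) * snd p \<partial>D) = (\<integral>p. g (fst p) * label_mean n D p \<partial>D)"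
    unfolding label_mean_def
    by (rule real_cond_exp_intg(2)[symmetric, OF integrable_point_label label_algebra(2)]) simp
  also have "\<dots> = (\<integral>p. g (fst p) * b (fst p) \<partial>D)"
    using assms by (intro integral_cong_AE) auto
  also have "\<dots> = cube_avg n (\<lambda>x. g x * b x)"
    using expectation_point[of "\<lambda>x. g x * b x"] by simp
  finally show ?thesis .
qed

lemma hyp_error_eq_cube_avg:
  assumes "AE p in D. label_mean n D p = b (fst p)"
  shows "hyp_error n D h = cube_avg n (\<lambda>x. (h x - b x)\<^sup>2)"
proof -
  note [measurable] = measurable_label_mean
  have "hyp_error n D h = (\<integral>p. (h (fst p) - b (fst p))\<^sup>2 \<partial>D)"
    unfolding hyp_error_def using assms by (intro integral_cong_AE) auto
  then show ?thesis using expectation_point[of "\<lambda>x. (h x - b x)\<^sup>2"] by simp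
qed

end

text \<open>Causality: residual \<open>r\<close> depends only on the examples up to
  \<open>r\<close>. Hence the predictor of round \<open>t\<close> is a function of the examples
  before \<open>t\<close>, as the martingale argument needs.\<close>

lemma residual_restrict:
  "r < t \<Longrightarrow> residual u \<eta> k (restrict \<omega> {..<t}) r = residual u \<eta> k \<omega> r"
proof (induction r rule: less_induct)
  case (less r)
  have "(\<Sum>r'<r. \<eta> * residual u \<eta> k (restrict \<omega> {..<t}) r' *
            kernel k (fst (restrict \<omega> {..<t} r')) (fst (restrict \<omega> {..<t} r)))
      = (\<Sum>r'<r. \<eta> * residual u \<eta> k \<omega> r' * kernel k (fst (\<omega> r')) (fst (\<omega> r)))"
  proof (intro sum.cong refl)
    fix r' assume "r' \<in> {..<r}"
    then have "residual u \<eta> k (restrict \<omega> {..<t}) r' = residual u \<eta> k \<omega> r'"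
      by (intro less.IH) (use less.prems in auto)
    then show "\<eta> * residual u \<eta> k (restrict \<omega> {..<t}) r' *
            kernel k (fst (restrict \<omega> {..<t} r')) (fst (restrict \<omega> {..<t} r))
        = \<eta> * residual u \<eta> k \<omega> r' * kernel k (fst (\<omega> r')) (fst (\<omega> r))"
      using less.prems \<open>r' \<in> {..<r}\<close> by simp
  qed
  then show ?case
    using less.prems by (simp only: residual.simps[of _ _ _ _ r]) simp
qed

lemma predictor_restrict:
  "predictor u \<eta> k (restrict \<omega> {..<t}) t x = predictor u \<eta> k \<omega> t x"
  unfolding margin_def by (intro arg_cong[where f = uminus] sum.cong) (simp_all add: residual_restrict)

lemma lipschitz_mono_square_le:
  fixes u :: "real \<Rightarrow> real"
  assumes "mono u" "L-lipschitz_on UNIV u"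
  shows "(u p - u q)\<^sup>2 \<le> L * ((u p - u q) * (p - q))"
proof -
  have "\<bar>u p - u q\<bar> \<le> L * \<bar>p - q\<bar>"
    using lipschitz_onD[OF assms(2), of p q] by (simp add: dist_real_def)
  then have "\<bar>u p - u q\<bar> * \<bar>u p - u q\<bar> \<le> \<bar>u p - u q\<bar> * (L * \<bar>p - q\<bar>)"
    by (intro mult_left_mono) auto
  moreover have "\<bar>u p - u q\<bar> * \<bar>p - q\<bar> = (u p - u q) * (p - q)"
    using monoD[OF assms(1), of p q] monoD[OF assms(1), of q p]
    by (cases "p \<le> q") (auto simp: abs_if algebra_simps)
  ultimately show ?thesis by (simp add: power2_eq_square mult_ac)
qed

text \<open>Jensen's inequality for the square, by Cauchy-Schwarz against the constant 1.\<close>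

lemma square_avg_le:
  fixes a :: "nat \<Rightarrow> real"
  assumes "0 < N"
  shows "((\<Sum>t<N. a t) / N - b)\<^sup>2 \<le> (\<Sum>t<N. (a t - b)\<^sup>2) / N"
proof -
  have "(\<Sum>t<N. a t) / N - b = (\<Sum>t<N. 1 * (a t - b)) / N"
    using assms by (simp add: sum_subtractf diff_divide_distrib)
  also have "\<dots>\<^sup>2 \<le> (\<Sum>t<N. 1\<^sup>2) * (\<Sum>t<N. (a t - b)\<^sup>2) / (real N)\<^sup>2"
    unfolding power_divide by (intro divide_right_mono Cauchy_Schwarz_ineq_sum) auto
  also have "\<dots> = (\<Sum>t<N. (a t - b)\<^sup>2) / N"
    using assms by (simp add: power2_eq_square)
  finally show ?thesis .
qed

section \<open>Analysis of a single learning problem\<close>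

locale glm_learning =
  fixes n d :: nat and M L \<epsilon> \<delta> :: real and u :: "real \<Rightarrow> real"
    and f :: "(nat \<Rightarrow> real) \<Rightarrow> real" and D :: "example measure"
  assumes eps: "0 < \<epsilon>" and del: "0 < \<delta>" "\<delta> < 1"
    and u: "mono u" "L-lipschitz_on UNIV u" "range u \<subseteq> {0..1}"
    and f: "f \<in> cube n \<rightarrow> {- M..M}"
    and D: "uniform_marginal_dist n D"
    and mean: "AE p in D. label_mean n D p = u (f (fst p))"
    and conc: "fourier_concentrated n \<epsilon> d f"
begin

abbreviation "k \<equiv> eff_dim n d"
abbreviation "A \<equiv> radius n d M \<epsilon>"
abbreviation "N \<equiv> rounds n d M \<epsilon> \<delta>"
abbreviation "\<eta> \<equiv> step_size n d M \<epsilon> \<delta>"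
abbreviation "q \<equiv> predictor u \<eta> k"
abbreviation "g \<equiv> low_degree n d f"
abbreviation "P \<equiv> \<lambda>t. Pi\<^sub>M {..<t :: nat} (\<lambda>_. D)"

lemma u_range: "0 \<le> u z" "u z \<le> 1"
  using u(3) by (auto simp: image_subset_iff)

lemma M_nonneg: "0 \<le> M"
proof -
  obtain x where "x \<in> cube n" using cube_nonempty by blast
  then show ?thesis using f by (fastforce simp: Pi_iff)
qed

lemma f_abs: "x \<in> cube n \<Longrightarrow> \<bar>f x\<bar> \<le> M"
  using f by (auto simp: abs_le_iff Pi_iff minus_le_iff)

lemma radius_eq: "A = M\<^sup>2 * weight n d / \<epsilon>\<^sup>2 + 1"
  by (simp add: radius_def power2_eq_square)

lemma radius_ge_1: "1 \<le> A"
  using weight_ge_1[of n d] by (simp add: radius_eq)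

lemma rounds_ge: "32 * A\<^sup>2 * (log_bound \<delta> + 1) \<le> N"
  using real_nat_ceiling_ge[of "32 * A * A * real (log_bound \<delta> + 1)"]
  by (simp add: rounds_def power2_eq_square mult.assoc)

lemma rounds_ge_radius: "32 * A \<le> N"
proof -
  have "32 * A * 1 \<le> 32 * A * (A * (log_bound \<delta> + 1))"
    using radius_ge_1 mult_mono[of 1 A 1 "real (log_bound \<delta> + 1)"] by (intro mult_left_mono) auto
  then show ?thesis using rounds_ge by (simp add: power2_eq_square mult_ac)
qed

lemma rounds_pos: "0 < N"
  using rounds_ge_radius radius_ge_1 by linarith

lemma step_size_pos: "0 < \<eta>"
  using eps radius_ge_1 rounds_pos by (simp add: step_size_def)

lemma step_size_rounds: "\<eta> * N = \<epsilon> * A"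
  using rounds_pos by (simp add: step_size_def)

lemma weight_bound: "M\<^sup>2 * weight n d \<le> \<epsilon>\<^sup>2 * A"
  using eps by (simp add: radius_eq field_simps)

lemma space_P: "\<omega> \<in> space (P t) \<Longrightarrow> r < t \<Longrightarrow> \<omega> r \<in> space D"
  by (auto simp: space_PiM PiE_iff)

lemma space_D: "p \<in> space D \<Longrightarrow> fst p \<in> cube n \<and> 0 \<le> snd p \<and> snd p \<le> 1"
  by (auto simp: space_examples[OF D])

lemma abs_residual_le:
  assumes "\<omega> r \<in> space D"
  shows "\<bar>residual u \<eta> k \<omega> r\<bar> \<le> 1"
  using space_D[OF assms] u_range[of "q \<omega> r (fst (\<omega> r))"]
  by (simp add: residual_eq_margin abs_le_iff)

text \<open>Each of at most \<open>N\<close> updates changes the margin by at most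
  \<open>\<eta> * 3\<close>, and \<open>\<eta> * N = \<epsilon> * A\<close>.\<close>

lemma abs_predictor_le:
  assumes \<omega>: "\<omega> \<in> space (P t)" and t: "t \<le> N" and x: "x \<in> cube n"
  shows "\<bar>q \<omega> t x\<bar> \<le> 3 * (\<epsilon> * A)"
proof -
  have "\<bar>q \<omega> t x\<bar> \<le> (\<Sum>r<t. \<bar>\<eta> * residual u \<eta> k \<omega> r * kernel k (fst (\<omega> r)) x\<bar>)"
    unfolding margin_def by (simp add: sum_abs)
  also have "\<dots> \<le> (\<Sum>r<t. \<eta> * 3)"
  proof (intro sum_mono)
    fix r assume "r \<in> {..<t}"
    then have "\<omega> r \<in> space D" using space_P[OF \<omega>] by simp
    then have "\<bar>residual u \<eta> k \<omega> r\<bar> * \<bar>kernel k (fst (\<omega> r)) x\<bar> \<le> 1 * 3"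
      using x space_D by (intro mult_mono abs_residual_le abs_kernel_le[of _ n] eff_dim_le) auto
    then show "\<bar>\<eta> * residual u \<eta> k \<omega> r * kernel k (fst (\<omega> r)) x\<bar> \<le> \<eta> * 3"
      using step_size_pos by (simp add: abs_mult)
  qed
  also have "\<dots> = 3 * (\<eta> * t)" by simp
  also have "\<dots> \<le> 3 * (\<eta> * N)"
    using t step_size_pos by (intro mult_left_mono) auto
  finally show ?thesis by (simp add: step_size_rounds)
qed

lemma abs_low_degree_radius:
  assumes x: "x \<in> cube n"
  shows "\<bar>g x\<bar> \<le> \<epsilon> * A"
proof -
  define a where "a = M\<^sup>2 * weight n d / \<epsilon>\<^sup>2"
  have "0 \<le> a" using weight_ge_1[of n d] by (simp add: a_def)
  have "(g x)\<^sup>2 \<le> 3 * (M\<^sup>2 * weight n d)"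
    by (rule low_degree_square_le[OF f_abs x])
  also have "\<dots> = \<epsilon>\<^sup>2 * (3 * a)" using eps by (simp add: a_def)
  also have "\<dots> \<le> \<epsilon>\<^sup>2 * (a + 1)\<^sup>2"
  proof (intro mult_left_mono)
    \<comment> \<open>The difference \<open>a\<^sup>2 - a + 1\<close> is positive, by completing the
      square; this lets \<open>A\<close> itself serve in the bound without a square root.\<close>
    have "(a + 1)\<^sup>2 = 3 * a + ((a - 1/2)\<^sup>2 + 3/4)" by (simp add: power2_eq_square algebra_simps)
    then show "3 * a \<le> (a + 1)\<^sup>2" by simp
  qed simp
  also have "\<dots> = (\<epsilon> * A)\<^sup>2" by (simp add: power_mult_distrib radius_eq a_def)
  finally show ?thesis using eps radius_ge_1 by (simp add: abs_le_square_iff[symmetric])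
qed

text \<open>The surrogate loss linearised at the current margin, against the comparator
  \<open>g\<close>. At \<open>p = \<omega> t\<close> it is what gradient descent controls;
  integrated over \<open>p\<close> it is what bounds the error.\<close>

definition regret :: "nat \<Rightarrow> (nat \<Rightarrow> example) \<Rightarrow> example \<Rightarrow> real" where
  "regret t \<omega> p = (u (q \<omega> t (fst p)) - snd p) * (q \<omega> t (fst p) - g (fst p))"

lemma abs_regret_le:
  assumes "\<omega> \<in> space (P t)" "t \<le> N" "p \<in> space D"
  shows "\<bar>regret t \<omega> p\<bar> \<le> 4 * (\<epsilon> * A)"
proof -
  have p: "fst p \<in> cube n" "0 \<le> snd p" "snd p \<le> 1" using space_D[OF assms(3)] by auto
  have "\<bar>regret t \<omega> p\<bar> \<le> 1 * (3 * (\<epsilon> * A) + \<epsilon> * A)"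
    unfolding regret_def abs_mult
  proof (intro mult_mono)
    show "\<bar>u (q \<omega> t (fst p)) - snd p\<bar> \<le> 1" using p u_range[of "q \<omega> t (fst p)"] by linarith
    show "\<bar>q \<omega> t (fst p) - g (fst p)\<bar> \<le> 3 * (\<epsilon> * A) + \<epsilon> * A"
      using abs_predictor_le[OF assms(1,2) p(1)] abs_low_degree_radius[OF p(1)] by linarith
  qed auto
  then show ?thesis by simp
qed

lemma u_measurable [measurable]: "u \<in> borel_measurable borel"
  by (rule borel_measurable_mono[OF u(1)])


text \<open>The sample sequence is a general function \<open>h\<close> of \<open>z\<close> because
  it is later both a point of the product space and the first component of a pair.\<close>

lemma residual_measurable:
  assumes "\<And>r'. r' \<le> r \<Longrightarrow> (\<lambda>z. h z r') \<in> S \<rightarrow>\<^sub>M D"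
  shows "(\<lambda>z. residual u \<eta> k (h z) r) \<in> borel_measurable S"
  using assms
proof (induction r rule: less_induct)
  case (less r)
  have K: "(\<lambda>z. kernel k (fst (h z r')) (fst (h z r))) \<in> borel_measurable S" if "r' < r" for r'
  proof -
    have coord: "(\<lambda>z. fst (h z r'') i) \<in> borel_measurable S" if "r'' \<le> r" for r'' i
      by (rule measurable_point[OF D, where g = "\<lambda>x. x i"]) (rule less.prems[OF that])
    show ?thesis
      unfolding kernel_def
      by (intro borel_measurable_prod borel_measurable_add borel_measurable_divide borel_measurable_times
          borel_measurable_const coord) (use that in auto)
  qed
  have R: "(\<lambda>z. residual u \<eta> k (h z) r') \<in> borel_measurable S" if "r' < r" for r'
    by (rule less.IH[OF that less.prems]) (use that in auto)
  have "(\<lambda>z. \<Sum>r'<r. \<eta> * residual u \<eta> k (h z) r' * kernel k (fst (h z r')) (fst (h z r))) \<in> borel_measurable S"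
    using K R by (intro borel_measurable_sum borel_measurable_times borel_measurable_const) auto
  moreover have "(\<lambda>z. snd (h z r)) \<in> borel_measurable S"
    by (rule measurable_label[OF D]) (rule less.prems[OF order_refl])
  ultimately show ?case
    by (subst residual.simps)
       (intro borel_measurable_diff measurable_compose[OF _ u_measurable] borel_measurable_uminus)
qed

lemma predictor_measurable:
  assumes "\<And>r. r < t \<Longrightarrow> (\<lambda>z. h z r) \<in> S \<rightarrow>\<^sub>M D"
    and "\<And>i. (\<lambda>z. x z i) \<in> borel_measurable S"
  shows "(\<lambda>z. q (h z) t (x z)) \<in> borel_measurable S"
proof -
  have coord: "(\<lambda>z. fst (h z r) i) \<in> borel_measurable S" if "r < t" for r i
    by (rule measurable_point[OF D, where g = "\<lambda>x. x i"]) (rule assms(1)[OF that])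
  have "(\<lambda>z. kernel k (fst (h z r)) (x z)) \<in> borel_measurable S" if "r < t" for r
    unfolding kernel_def
    by (intro borel_measurable_prod borel_measurable_add borel_measurable_divide borel_measurable_times
        borel_measurable_const coord assms(2) that)
  moreover have "(\<lambda>z. residual u \<eta> k (h z) r) \<in> borel_measurable S" if "r < t" for r
    by (rule residual_measurable) (use that assms(1) in auto)
  ultimately show ?thesis
    unfolding margin_def
    by (intro borel_measurable_uminus borel_measurable_sum borel_measurable_times borel_measurable_const) auto
qed

lemma regret_measurable: "case_prod (regret t) \<in> borel_measurable (P t \<Otimes>\<^sub>M D)"
proof -
  have "(\<lambda>z. q (fst z) t (fst (snd z))) \<in> borel_measurable (P t \<Otimes>\<^sub>M D)"
  proof (rule predictor_measurable)
    fix r assume "r < t"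
    then show "(\<lambda>z. fst z r) \<in> P t \<Otimes>\<^sub>M D \<rightarrow>\<^sub>M D"
      by (intro measurable_compose[OF measurable_fst measurable_component_singleton]) simp
  qed (rule measurable_point[OF D measurable_snd])
  moreover have "(\<lambda>z. g (fst (snd z))) \<in> borel_measurable (P t \<Otimes>\<^sub>M D)"
    by (rule measurable_point[OF D measurable_snd])
  moreover have "(\<lambda>z. snd (snd z)) \<in> borel_measurable (P t \<Otimes>\<^sub>M D)"
    by (rule measurable_label[OF D measurable_snd])
  ultimately show ?thesis
    unfolding regret_def split_beta' by measurable
qed

text \<open>The label enters linearly, so its conditional mean \<open>u (f x)\<close> takes its
  place.\<close>

lemma expectation_regret:
  "(\<integral>p. regret t \<omega> p \<partial>D) = cube_avg n (\<lambda>x. (u (q \<omega> t x) - u (f x)) * (q \<omega> t x - g x))"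
proof -
  define a where "a x = q \<omega> t x - g x" for x
  have "(\<integral>p. regret t \<omega> p \<partial>D) = (\<integral>p. u (q \<omega> t (fst p)) * a (fst p) - a (fst p) * snd p \<partial>D)"
    by (simp add: regret_def a_def left_diff_distrib mult_ac)
  also have "\<dots> = (\<integral>p. u (q \<omega> t (fst p)) * a (fst p) \<partial>D) - (\<integral>p. a (fst p) * snd p \<partial>D)"
    by (rule Bochner_Integration.integral_diff[OF integrable_point[OF D, of "\<lambda>x. u (q \<omega> t x) * a x"]
          integrable_point_label[OF D]])
  also have "\<dots> = cube_avg n (\<lambda>x. u (q \<omega> t x) * a x) - cube_avg n (\<lambda>x. a x * u (f x))"
    using expectation_point[OF D, of "\<lambda>x. u (q \<omega> t x) * a x"] expectation_point_label[OF D mean, of a] by simp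
  finally show ?thesis
    by (simp add: a_def left_diff_distrib mult_ac flip: cube_avg_diff)
qed

text \<open>Valid for every sample sequence. Expanding the kernel into features shows that
  \<open>q \<omega> t\<close> is given by the gradient descent weights \<open>?w t\<close>, just as
  \<open>g\<close> is given by \<open>low_weights n d f\<close>, so the regret bound
  applies.\<close>

lemma sum_regret_le:
  assumes \<omega>: "\<omega> \<in> space (P N)"
  shows "(\<Sum>t<N. regret t \<omega> (\<omega> t)) \<le> N * \<epsilon>"
proof -
  let ?c = "residual u \<eta> k \<omega>" and ?\<phi> = "\<lambda>S t. feature k S (fst (\<omega> t))" and ?v = "low_weights n d f"
  let ?w = "\<lambda>t S. - (\<Sum>r<t. \<eta> * ?c r * ?\<phi> S r)"
  have \<omega>D: "\<omega> t \<in> space D" if "t < N" for t using space_P[OF \<omega> that] .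
  have "regret t \<omega> (\<omega> t) = ?c t * (\<Sum>S\<in>Pow {..<k}. (?w t S - ?v S) * ?\<phi> S t)" for t
  proof -
    have "(\<Sum>r<t. \<eta> * ?c r * (\<Sum>S\<in>Pow {..<k}. ?\<phi> S r * ?\<phi> S t))
        = (\<Sum>r<t. \<Sum>S\<in>Pow {..<k}. \<eta> * ?c r * ?\<phi> S r * ?\<phi> S t)"
      by (simp add: sum_distrib_left mult.assoc)
    also have "\<dots> = (\<Sum>S\<in>Pow {..<k}. \<Sum>r<t. \<eta> * ?c r * ?\<phi> S r * ?\<phi> S t)"
      by (rule sum.swap)
    finally have "q \<omega> t (fst (\<omega> t)) = (\<Sum>S\<in>Pow {..<k}. ?w t S * ?\<phi> S t)"
      by (simp add: margin_def kernel_eq_feature sum_distrib_right sum_negf)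
    then show ?thesis
      by (simp add: regret_def residual_eq_margin low_degree_eq_feature left_diff_distrib sum_subtractf)
  qed
  then have "(\<Sum>t<N. regret t \<omega> (\<omega> t)) \<le> (\<Sum>S\<in>Pow {..<k}. (?v S)\<^sup>2) / (2 * \<eta>) + \<eta> * 3 * N / 2"
  proof (simp only:, intro gradient_descent_regret step_size_pos)
    fix t assume t: "t < N"
    show "\<bar>?c t\<bar> \<le> 1" by (rule abs_residual_le) (rule \<omega>D[OF t])
    show "(\<Sum>S\<in>Pow {..<k}. (?\<phi> S t)\<^sup>2) \<le> 3"
      using abs_kernel_le[of "fst (\<omega> t)" n "fst (\<omega> t)" k] space_D[OF \<omega>D[OF t]] eff_dim_le[of n d]
      by (simp add: kernel_eq_feature power2_eq_square)
  qed
  also have "\<dots> \<le> \<epsilon>\<^sup>2 * A / (2 * \<eta>) + 3 * (\<epsilon> * A) / 2"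
  proof (intro add_mono divide_right_mono)
    show "(\<Sum>S\<in>Pow {..<k}. (?v S)\<^sup>2) \<le> \<epsilon>\<^sup>2 * A"
      using sum_low_weights_le[OF f_abs] weight_bound by (rule order_trans)
  qed (use step_size_pos step_size_rounds in simp_all)
  \<comment> \<open>The step size makes this term exactly half of the budget
    \<open>N * \<epsilon>\<close>; the other half absorbs the second term, since \<open>N\<close>
    exceeds \<open>3 * A\<close>.\<close>
  also have "\<epsilon>\<^sup>2 * A / (2 * \<eta>) = N * \<epsilon> / 2"
    using eps radius_ge_1 rounds_pos by (simp add: step_size_def power2_eq_square field_simps)
  also have "N * \<epsilon> / 2 + 3 * (\<epsilon> * A) / 2 \<le> N * \<epsilon>"
  proof -
    have "3 * A * \<epsilon> \<le> N * \<epsilon>"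
      using rounds_ge_radius radius_ge_1 eps by (intro mult_right_mono) auto
    then show ?thesis by (simp add: mult_ac)
  qed
  finally show ?thesis .
qed

text \<open>A sum of martingale differences, since \<open>regret t\<close> sees only the examples
  before round \<open>t\<close> (\<open>regret_restrict\<close>).\<close>

definition deviation :: "(nat \<Rightarrow> example) \<Rightarrow> real" where
  "deviation \<omega> = (\<Sum>t<N. (\<integral>p. regret t \<omega> p \<partial>D) - regret t \<omega> (\<omega> t))"

lemma regret_restrict: "regret t (restrict \<omega> {..<t}) = regret t \<omega>"
  by (rule ext) (simp only: regret_def predictor_restrict)

text \<open>The factor 3 counts three contributions of \<open>N * \<epsilon>\<close>: the deviation,
  the regret on the sample, and the Fourier tail of \<open>f\<close>.\<close>

lemma hyp_error_le:
  assumes \<omega>: "\<omega> \<in> space (P N)" and dev: "deviation \<omega> \<le> N * \<epsilon>"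
  shows "hyp_error n D (learned_hyp u \<eta> k N \<omega>) \<le> 3 * (L * \<epsilon>)"
proof -
  have L: "0 \<le> L" using u(2) by (rule lipschitz_on_nonneg)
  have N: "0 < real N" using rounds_pos by simp
  have "hyp_error n D (learned_hyp u \<eta> k N \<omega>)
      = cube_avg n (\<lambda>x. ((\<Sum>t<N. u (q \<omega> t x)) / N - u (f x))\<^sup>2)"
    by (simp add: hyp_error_eq_cube_avg[OF D mean] learned_hyp_def)
  \<comment> \<open>Convexity moves the average over rounds out of the square; each summand is then
    linearised.\<close>
  also have "\<dots> \<le> cube_avg n (\<lambda>x. (\<Sum>t<N. L * ((u (q \<omega> t x) - u (f x)) * (q \<omega> t x - f x))) / N)"
  proof (rule cube_avg_mono)
    fix x
    show "((\<Sum>t<N. u (q \<omega> t x)) / N - u (f x))\<^sup>2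
        \<le> (\<Sum>t<N. L * ((u (q \<omega> t x) - u (f x)) * (q \<omega> t x - f x))) / N"
      by (rule order_trans[OF square_avg_le[OF rounds_pos]])
         (intro divide_right_mono sum_mono lipschitz_mono_square_le u, simp)
  qed
  \<comment> \<open>Inserting \<open>g x\<close> separates the expected regret from the high-degree
    error.\<close>
  also have "\<dots> = cube_avg n (\<lambda>x. (L / N) * (\<Sum>t<N. (u (q \<omega> t x) - u (f x)) * (q \<omega> t x - g x)
      + (u (q \<omega> t x) - u (f x)) * (g x - f x)))"
  proof (rule cube_avg_cong)
    fix x
    have "(u (q \<omega> t x) - u (f x)) * (q \<omega> t x - f x)
        = (u (q \<omega> t x) - u (f x)) * (q \<omega> t x - g x) + (u (q \<omega> t x) - u (f x)) * (g x - f x)" for t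
      by (simp add: right_diff_distrib)
    then show "(\<Sum>t<N. L * ((u (q \<omega> t x) - u (f x)) * (q \<omega> t x - f x))) / N
        = (L / N) * (\<Sum>t<N. (u (q \<omega> t x) - u (f x)) * (q \<omega> t x - g x)
      + (u (q \<omega> t x) - u (f x)) * (g x - f x))"
      by (simp only: sum_distrib_left[symmetric] times_divide_eq_left)
  qed
  also have "\<dots> = (L / N) * (\<Sum>t<N. (\<integral>p. regret t \<omega> p \<partial>D)
      + cube_avg n (\<lambda>x. (u (q \<omega> t x) - u (f x)) * (g x - f x)))"
    by (simp only: cube_avg_cmult cube_avg_sum cube_avg_add expectation_regret)
  also have "\<dots> \<le> (L / N) * (3 * (N * \<epsilon>))"
  proof (intro mult_left_mono)
    have "cube_avg n (\<lambda>x. (u (q \<omega> t x) - u (f x)) * (g x - f x)) \<le> \<epsilon>" for t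
    proof (rule high_degree_inner_le[OF conc])
      fix x
      show "\<bar>u (q \<omega> t x) - u (f x)\<bar> \<le> 1"
        using u_range[of "q \<omega> t x"] u_range[of "f x"] by linarith
    qed (use eps in simp)
    then have "(\<Sum>t<N. cube_avg n (\<lambda>x. (u (q \<omega> t x) - u (f x)) * (g x - f x))) \<le> (\<Sum>t<N. \<epsilon>)"
      by (intro sum_mono)
    moreover have "(\<Sum>t<N. \<integral>p. regret t \<omega> p \<partial>D) \<le> N * \<epsilon> + N * \<epsilon>"
      using add_mono[OF dev sum_regret_le[OF \<omega>]] by (simp add: deviation_def sum_subtractf)
    ultimately show "(\<Sum>t<N. (\<integral>p. regret t \<omega> p \<partial>D)
      + cube_avg n (\<lambda>x. (u (q \<omega> t x) - u (f x)) * (g x - f x))) \<le> 3 * (N * \<epsilon>)"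
      by (simp add: sum.distrib mult.commute[of \<epsilon>])
  qed (use L in simp)
  also have "\<dots> = 3 * (L * \<epsilon>)" using N by simp
  finally show ?thesis .
qed

lemma log_bound_ge: "1 \<le> 2 ^ log_bound \<delta> * \<delta>"
  unfolding log_bound_def using log_bound_exists[OF del(1)] by (rule LeastI_ex)

lemma deviation_prob:
  "deviation \<in> borel_measurable (P N)"
  "measure (P N) {\<omega> \<in> space (P N). N * \<epsilon> \<le> deviation \<omega>} \<le> \<delta>"
proof -
  let ?R = "4 * (\<epsilon> * A)"
  have R: "0 < ?R" using eps radius_ge_1 by simp
  have dev: "deviation = (\<lambda>\<omega>. \<Sum>t<N. (\<integral>p. regret t (restrict \<omega> {..<t}) p \<partial>D) - regret t (restrict \<omega> {..<t}) (\<omega> t))"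
    by (simp add: deviation_def fun_eq_iff regret_restrict)
  note azuma = azuma_hoeffding_PiM[of D ?R \<epsilon> N regret, OF prob_space_examples[OF D] R eps rounds_pos
      regret_measurable abs_regret_le[OF _ less_imp_le]]
  show "deviation \<in> borel_measurable (P N)" unfolding dev by (rule azuma)
  have "measure (P N) {\<omega> \<in> space (P N). N * \<epsilon> \<le> deviation \<omega>} \<le> exp (- real N * \<epsilon>\<^sup>2 / (2 * ?R\<^sup>2))"
    unfolding dev by (rule azuma)
  \<comment> \<open>The \<open>\<epsilon>\<close> cancels against the one in \<open>?R\<close>,
    leaving \<open>2 * 4\<^sup>2 = 32\<close>, the constant in \<open>rounds\<close>.\<close>
  also have "- real N * \<epsilon>\<^sup>2 / (2 * ?R\<^sup>2) = - (N / (32 * A\<^sup>2))"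
    using eps radius_ge_1 by (simp add: power2_eq_square)
  \<comment> \<open>\<open>N\<close> is large enough for the tail
    \<open>exp (- log_bound \<delta>)\<close>; since \<open>ln 2 < 1\<close>, this is below a power
    of two comparable with \<open>\<delta>\<close>.\<close>
  also have "exp (- (N / (32 * A\<^sup>2))) \<le> exp (- (real (log_bound \<delta>) * ln 2))"
  proof -
    have "real (log_bound \<delta>) * ln 2 \<le> real (log_bound \<delta>) * 1"
      using ln_2_less_1 by (intro mult_left_mono) auto
    also have "\<dots> \<le> N / (32 * A\<^sup>2)"
    proof -
      have "real (log_bound \<delta>) * (32 * A\<^sup>2) \<le> N"
        by (rule order_trans[OF _ rounds_ge]) (simp add: algebra_simps)
      moreover have "0 < 32 * A\<^sup>2" using radius_ge_1 by simp
      ultimately show ?thesis by (simp only: pos_le_divide_eq mult_1_right)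
    qed
    finally show ?thesis by simp
  qed
  also have "\<dots> = 1 / 2 ^ log_bound \<delta>"
    by (simp add: exp_minus exp_of_nat_mult inverse_eq_divide)
  also have "\<dots> \<le> \<delta>" using log_bound_ge by (simp add: field_simps)
  finally show "measure (P N) {\<omega> \<in> space (P N). N * \<epsilon> \<le> deviation \<omega>} \<le> \<delta>" .
qed

lemma learned_hyp_error_prob:
  "1 - \<delta> \<le> measure (P N) {\<omega> \<in> space (P N). hyp_error n D (learned_hyp u \<eta> k N \<omega>) \<le> 3 * (L * \<epsilon>)}"
proof -
  interpret P: prob_space "P N" by (rule prob_space_PiM) (rule prob_space_examples[OF D])
  note [measurable] = deviation_prob(1)
  have "(\<lambda>\<omega>. q \<omega> t x) \<in> borel_measurable (P N)" if "t < N" for t x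
    by (rule predictor_measurable) (use that in auto)
  then have "(\<lambda>\<omega>. learned_hyp u \<eta> k N \<omega> x) \<in> borel_measurable (P N)" for x
    unfolding learned_hyp_def
    by (intro borel_measurable_divide borel_measurable_sum borel_measurable_const
        measurable_compose[OF _ u_measurable]) auto
  \<comment> \<open>\<open>measure\<close> is 0 on non-measurable sets, so the error event must be
    measurable before monotonicity can be used.\<close>
  then have [measurable]: "(\<lambda>\<omega>. hyp_error n D (learned_hyp u \<eta> k N \<omega>)) \<in> borel_measurable (P N)"
    unfolding hyp_error_eq_cube_avg[OF D mean] cube_avg_def by measurable
  have "1 - \<delta> \<le> 1 - P.prob {\<omega> \<in> space (P N). N * \<epsilon> \<le> deviation \<omega>}"
    using deviation_prob(2) by simp
  also have "\<dots> = P.prob {\<omega> \<in> space (P N). \<not> N * \<epsilon> \<le> deviation \<omega>}"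
    by (rule P.prob_neg[symmetric]) simp
  also have "\<dots> \<le> P.prob {\<omega> \<in> space (P N). hyp_error n D (learned_hyp u \<eta> k N \<omega>) \<le> 3 * (L * \<epsilon>)}"
    using hyp_error_le by (intro P.finite_measure_mono) auto
  finally show ?thesis .
qed

end

section \<open>Polynomial bounds\<close>

text \<open>For non-negative arguments this single quantity dominates them all, so every bound
  becomes a constant times one of its powers.\<close>

definition poly_scale :: "real \<Rightarrow> real \<Rightarrow> real \<Rightarrow> real \<Rightarrow> real" where
  "poly_scale w x y z = (1 + w) * (1 + x) * (1 + y) * (1 + z)"

lemma is_polynomial4_scale_power: "is_polynomial4 (\<lambda>w x y z. C * poly_scale w x y z ^ a)"
  unfolding is_polynomial4_def
proof (intro exI[of _ a] exI[of _ "\<lambda>i j p q. C * of_nat (a choose i) * of_nat (a choose j) * of_nat (a choose p) * of_nat (a choose q)"] ext)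
  fix w x y z :: real
  define S where "S v = (\<Sum>i\<le>a. of_nat (a choose i) * v ^ i)" for v :: real
  have "(1 + v) ^ a = S v" for v :: real
    using binomial_ring[of v 1 a] by (simp add: S_def add.commute[of 1])
  then have "C * poly_scale w x y z ^ a = C * (S w * (S x * (S y * S z)))"
    by (simp only: poly_scale_def power_mult_distrib mult.assoc)
  also have "\<dots> = (\<Sum>i\<le>a. \<Sum>j\<le>a. \<Sum>p\<le>a. \<Sum>q\<le>a.
      C * of_nat (a choose i) * of_nat (a choose j) * of_nat (a choose p) * of_nat (a choose q) * w ^ i * x ^ j * y ^ p * z ^ q)"
    by (simp only: S_def sum_distrib_right, simp only: sum_distrib_left mult.assoc)
       (intro sum.cong refl, simp only: mult_ac)
  finally show "C * poly_scale w x y z ^ a = (\<Sum>i\<le>a. \<Sum>j\<le>a. \<Sum>p\<le>a. \<Sum>q\<le>a.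
      C * of_nat (a choose i) * of_nat (a choose j) * of_nat (a choose p) * of_nat (a choose q) * w ^ i * x ^ j * y ^ p * z ^ q)" .
qed

text \<open>Minimality gives \<open>2 ^ j < 1 / \<delta>\<close> for the predecessor
  \<open>j\<close>, and \<open>ln 2 \<ge> 1 / 2\<close> converts to the natural logarithm at the
  cost of a factor 2.\<close>

lemma log_bound_le:
  assumes "0 < \<delta>" "\<delta> < 1"
  shows "real (log_bound \<delta>) \<le> 2 * ln (1 / \<delta>) + 1"
proof (cases "log_bound \<delta>")
  case 0
  then show ?thesis using assms by simp
next
  case (Suc j)
  have "\<not> 1 \<le> 2 ^ j * \<delta>"
    using not_less_Least[of j "\<lambda>k. 1 \<le> 2 ^ k * \<delta>"] Suc by (simp add: log_bound_def)
  then have "2 ^ j < 1 / \<delta>" using assms by (simp add: field_simps)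
  then have "ln (2 ^ j) < ln (1 / \<delta>)" using assms by simp
  then have "j * ln 2 < ln (1 / \<delta>)" by (simp add: ln_realpow)
  moreover have "j * (1 / 2) \<le> j * ln (2 :: real)"
    using ln2_ge_two_thirds by (intro mult_left_mono) auto
  ultimately show ?thesis using Suc by simp
qed

context
  fixes n d :: nat and M \<epsilon> \<delta> :: real
  assumes eps: "0 < \<epsilon>" and del: "0 < \<delta>" "\<delta> < 1" and M: "0 \<le> M"
begin

abbreviation (input) "B \<equiv> poly_scale (real n ^ d) M (1 / \<epsilon>) (ln (1 / \<delta>))"

lemma scale_factors:
  "1 \<le> B" "real n ^ d + 1 \<le> B" "2 * ln (1 / \<delta>) + 1 \<le> 2 * B"
  "M\<^sup>2 * (real n ^ d + 1) / \<epsilon>\<^sup>2 \<le> B\<^sup>2"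
proof -
  define w where "w = 1 + real n ^ d"
  define z where "z = 1 + ln (1 / \<delta>)"
  have w: "1 \<le> w" and z: "1 \<le> z" using del by (auto simp: w_def z_def)
  have e: "0 < 1 / \<epsilon>" using eps by simp
  define r where "r = (1 + M) * (1 + 1 / \<epsilon>)"
  have "1 * 1 \<le> (1 + M) * (1 + 1 / \<epsilon>)" using M e by (intro mult_mono) auto
  then have r: "1 \<le> r" by (simp add: r_def)
  have B: "B = w * r * z" by (simp add: poly_scale_def w_def r_def z_def)
  have wr: "1 \<le> w * r" and rz: "1 \<le> r * z"
    using w r z mult_mono[of 1 w 1 r] mult_mono[of 1 r 1 z] by simp_all
  have "w * 1 \<le> w * (r * z)" using rz w by (intro mult_left_mono) auto
  then have wB: "w \<le> B" by (simp only: B mult.assoc mult_1_right)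
  then show "real n ^ d + 1 \<le> B" by (simp add: w_def)
  show "1 \<le> B" using w wB by linarith
  have "1 * z \<le> w * r * z" using wr z by (intro mult_right_mono) auto
  then show "2 * ln (1 / \<delta>) + 1 \<le> 2 * B" by (simp add: B z_def)
  have "M * (1 / \<epsilon>) \<le> r" unfolding r_def using M e by (intro mult_mono) auto
  then have "(M / \<epsilon>)\<^sup>2 \<le> r\<^sup>2" using M eps by (intro power_mono) auto
  \<comment> \<open>In \<open>B = w * r * z\<close>, the factor \<open>r\<close> pays for
    \<open>M / \<epsilon>\<close> and the remaining \<open>w * z\<close> for the weight.\<close>
  moreover have "w \<le> (w * z)\<^sup>2"
  proof -
    have "w * 1 \<le> w * z" using w z by (intro mult_left_mono) auto
    also have "\<dots> \<le> (w * z)\<^sup>2" using mult_mono[of 1 w 1 z] w z by (intro self_le_power) auto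
    finally show ?thesis by simp
  qed
  ultimately have "(M / \<epsilon>)\<^sup>2 * w \<le> r\<^sup>2 * (w * z)\<^sup>2" using w by (intro mult_mono) auto
  also have "r\<^sup>2 * (w * z)\<^sup>2 = B\<^sup>2" by (simp add: B power_mult_distrib)
  finally show "M\<^sup>2 * (real n ^ d + 1) / \<epsilon>\<^sup>2 \<le> B\<^sup>2"
    by (simp add: w_def power_divide add.commute)
qed

text \<open>The summand 1 covers \<open>n = 0\<close> with \<open>d > 0\<close>, where the power
  vanishes but the weight is 1.\<close>

lemma weight_le: "weight n d \<le> real n ^ d + 1"
  by (simp add: weight_def)

lemma eff_dim_le_scale: "real (eff_dim n d) \<le> B"
proof (cases "d = 0 \<or> n = 0")
  case True
  then show ?thesis using scale_factors(1) by (auto simp: eff_dim_def)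
next
  case False
  then have "real (eff_dim n d) = real n ^ 1" by (simp add: eff_dim_def)
  also have "\<dots> \<le> real n ^ d" using False by (intro power_increasing) auto
  also have "\<dots> \<le> B" using scale_factors(2) by linarith
  finally show ?thesis .
qed

text \<open>Pays for the weight loop: \<open>d < 2 ^ d \<le> n ^ d\<close> once
  \<open>n \<ge> 2\<close>, and for smaller \<open>n\<close> the loop makes no iteration.\<close>

lemma degree_le_scale: "real (if n \<le> 1 then 0 else d) \<le> B"
proof (cases "n \<le> 1")
  case True
  then show ?thesis using scale_factors(1) by simp
next
  case False
  have "real d \<le> 2 ^ d" by (rule less_imp_le) (rule of_nat_less_two_power)
  also have "\<dots> \<le> real n ^ d" using False by (intro power_mono) auto
  also have "\<dots> \<le> B" using scale_factors(2) by linarith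
  finally show ?thesis using False by simp
qed

lemma radius_le_scale: "radius n d M \<epsilon> \<le> 2 * B\<^sup>2"
proof -
  have "M\<^sup>2 * weight n d / \<epsilon>\<^sup>2 \<le> M\<^sup>2 * (real n ^ d + 1) / \<epsilon>\<^sup>2"
    by (intro divide_right_mono mult_left_mono weight_le) auto
  moreover have "1 \<le> B\<^sup>2" using scale_factors(1) by (rule one_le_power)
  ultimately show ?thesis using scale_factors(4) by (simp add: radius_def power2_eq_square)
qed

lemma radius_nonneg: "0 \<le> radius n d M \<epsilon>"
  using weight_ge_1[of n d] by (simp add: radius_def)

lemma rounds_le_scale: "real (rounds n d M \<epsilon> \<delta>) \<le> 400 * B ^ 5"
proof -
  let ?A = "radius n d M \<epsilon>"
  have B: "1 \<le> B" by (rule scale_factors)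
  have "log_bound \<delta> + 1 \<le> 3 * B"
    using log_bound_le[OF del] scale_factors(1,3) by linarith
  then have "32 * ?A * ?A * real (log_bound \<delta> + 1) \<le> 32 * (2 * B\<^sup>2) * (2 * B\<^sup>2) * (3 * B)"
    using radius_le_scale radius_nonneg by (intro mult_mono mult_nonneg_nonneg) auto
  \<comment> \<open>The gap between 384 and the final 400 absorbs the 1 lost by rounding up.\<close>
  also have "\<dots> = 384 * B ^ 5" using power_add[of B 2 2] power_add[of B 4 1] by simp
  finally have "32 * ?A * ?A * real (log_bound \<delta> + 1) \<le> 384 * B ^ 5" .
  moreover have "real (rounds n d M \<epsilon> \<delta>) \<le> 32 * ?A * ?A * real (log_bound \<delta> + 1) + 1"
  proof -
    have "0 \<le> 32 * ?A * ?A * real (log_bound \<delta> + 1)" using radius_nonneg by simp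
    then show ?thesis unfolding rounds_def by linarith
  qed
  moreover have "1 \<le> B ^ 5" using B by (rule one_le_power)
  ultimately show ?thesis by linarith
qed

lemma time_bound_le_scale: "real (time_bound n d M \<epsilon> \<delta>) \<le> 20000000 * B ^ 11"
proof -
  let ?N = "real (rounds n d M \<epsilon> \<delta>)" and ?k = "real (eff_dim n d)"
  have B: "1 \<le> B" by (rule scale_factors)
  have pw: "B ^ i \<le> B ^ 11" if "i \<le> 11" for i using B that by (rule power_increasing[rotated])
  have N: "?N \<le> 400 * B ^ 5" by (rule rounds_le_scale)
  have k: "?k \<le> B" by (rule eff_dim_le_scale)
  have "?N * ?k \<le> 400 * B ^ 5 * B" using N k B by (intro mult_mono) auto
  then have Nk: "?N * ?k \<le> 400 * B ^ 6" using power_add[of B 5 1] by simp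
  have "?N * ?N \<le> 400 * B ^ 5 * (400 * B ^ 5)" using N B by (intro mult_mono) auto
  then have NN: "?N * ?N \<le> 160000 * B ^ 10" using power_add[of B 5 5] by simp
  have "?N * (?N * ?k) \<le> 400 * B ^ 5 * (400 * B ^ 6)" using B by (intro mult_mono[OF N Nk]) auto
  then have NNk: "?N * (?N * ?k) \<le> 160000 * B ^ 11" using power_add[of B 5 6] by simp
  have lb: "real (log_bound \<delta>) \<le> 2 * B"
    using log_bound_le[OF del] scale_factors(3) by linarith
  \<comment> \<open>The last term has degree \<open>5 + 5 + 1\<close> in \<open>B\<close> and fixes
    the exponent 11; all lower powers are raised to it.\<close>
  have "real (time_bound n d M \<epsilon> \<delta>) =
      125 + 18 * real (if n \<le> 1 then 0 else d) + 19 * real (log_bound \<delta>) + 88 * ?N + 40 * (?N * ?k)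
        + 43 * (?N * ?N) + 27 * (?N * (?N * ?k))"
    by (simp add: time_bound_def Let_def algebra_simps)
  also have "\<dots> \<le> 20000000 * B ^ 11"
    using degree_le_scale lb N Nk NN NNk pw[of 0] pw[of 1] pw[of 5] pw[of 6] pw[of 10] by simp
  finally show ?thesis .
qed

end

theorem theorem7:
  shows "\<exists>(A :: learner) (C :: real) P Q (m :: nat \<Rightarrow> nat \<Rightarrow> real \<Rightarrow> real \<Rightarrow> real \<Rightarrow> nat).
    is_polynomial4 P \<and> is_polynomial4 Q \<and>
    (\<forall>(n :: nat) (d :: nat) (M :: real) (L :: real) (\<epsilon> :: real) (\<delta> :: real)
       (u :: real \<Rightarrow> real) (f :: (nat \<Rightarrow> real) \<Rightarrow> real) (D :: example measure).
      0 < \<epsilon> \<longrightarrow> 0 < \<delta> \<longrightarrow> \<delta> < 1 \<longrightarrow>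
      mono u \<longrightarrow> L-lipschitz_on UNIV u \<longrightarrow> range u \<subseteq> {0..1} \<longrightarrow>
      f \<in> cube n \<rightarrow> {- M..M} \<longrightarrow>
      uniform_marginal_dist n D \<longrightarrow>
      (AE p in D. label_mean n D p = u (f (fst p))) \<longrightarrow>
      fourier_concentrated n \<epsilon> d f \<longrightarrow>
      real (m n d M \<epsilon> \<delta>) \<le> P (real n ^ d) M (1 / \<epsilon>) (ln (1 / \<delta>)) \<and>
      (\<exists>h :: (nat \<Rightarrow> example) \<Rightarrow> (nat \<Rightarrow> real) \<Rightarrow> real.
        (\<forall>\<omega> \<in> space (\<Pi>\<^sub>M i\<in>{..<m n d M \<epsilon> \<delta>}. D).
           outputs_hyp A u n d M L \<epsilon> \<delta> \<omega> (m n d M \<epsilon> \<delta>)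
             (Q (real n ^ d) M (1 / \<epsilon>) (ln (1 / \<delta>))) (h \<omega>)) \<and>
        measure (\<Pi>\<^sub>M i\<in>{..<m n d M \<epsilon> \<delta>}. D)
          {\<omega> \<in> space (\<Pi>\<^sub>M i\<in>{..<m n d M \<epsilon> \<delta>}. D). hyp_error n D (h \<omega>) \<le> C * (L * \<epsilon>)}
          \<ge> 1 - \<delta>))"
proof (intro exI conjI allI impI)
  \<comment> \<open>The existential witnesses stay schematic until the facts shown below fix them;
    in particular \<open>C\<close> becomes 3 and \<open>m\<close> becomes
    \<open>rounds\<close>.\<close>
  show "is_polynomial4 (\<lambda>w x y z. 400 * poly_scale w x y z ^ 5)"
    by (rule is_polynomial4_scale_power)
  show "is_polynomial4 (\<lambda>w x y z. 20000000 * poly_scale w x y z ^ 11)"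
    by (rule is_polynomial4_scale_power)
  fix n d :: nat and M L \<epsilon> \<delta> :: real and u :: "real \<Rightarrow> real"
    and f :: "(nat \<Rightarrow> real) \<Rightarrow> real" and D :: "example measure"
  assume "0 < \<epsilon>" "0 < \<delta>" "\<delta> < 1" "mono u" "L-lipschitz_on UNIV u" "range u \<subseteq> {0..1}"
    "f \<in> cube n \<rightarrow> {- M..M}" "uniform_marginal_dist n D"
    "AE p in D. label_mean n D p = u (f (fst p))" "fourier_concentrated n \<epsilon> d f"
  then interpret glm_learning n d M L \<epsilon> \<delta> u f D by unfold_locales
  let ?h = "learned_hyp u (step_size n d M \<epsilon> \<delta>) (eff_dim n d) (rounds n d M \<epsilon> \<delta>)"
  show "real (rounds n d M \<epsilon> \<delta>) \<le> 400 * poly_scale (real n ^ d) M (1 / \<epsilon>) (ln (1 / \<delta>)) ^ 5"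
    by (rule rounds_le_scale[OF eps del M_nonneg])
  show "\<forall>\<omega> \<in> space (\<Pi>\<^sub>M i\<in>{..<rounds n d M \<epsilon> \<delta>}. D).
      outputs_hyp (train_prog, predict_prog) u n d M L \<epsilon> \<delta> \<omega> (rounds n d M \<epsilon> \<delta>)
        (20000000 * poly_scale (real n ^ d) M (1 / \<epsilon>) (ln (1 / \<delta>)) ^ 11) (?h \<omega>)"
    using outputs_learned_hyp[OF del(1) time_bound_le_scale[OF eps del M_nonneg]] by blast
  show "measure (\<Pi>\<^sub>M i\<in>{..<rounds n d M \<epsilon> \<delta>}. D)
      {\<omega> \<in> space (\<Pi>\<^sub>M i\<in>{..<rounds n d M \<epsilon> \<delta>}. D). hyp_error n D (?h \<omega>) \<le> 3 * (L * \<epsilon>)} \<ge> 1 - \<delta>"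
    by (rule learned_hyp_error_prob)
qed

end
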